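(* Let $Y\subset\mathbb{R}^n$ be a Lebesgue measurable set of finite positive Lebesgue measure, let $(X,\mu)$ be a measure-interval with $\mu(X)=\lambda_n(Y)$, let $u:X\to\mathbb{R}^n$ be integrable and let $u^{\#}$ be the monotone rearrangement of $u$ on $Y$. Suppose there is a Borel set $B\subset\mathbb{R}^n$ such that (i) the restriction of $u^{\#}$ to $(u^{\#})^{-1}(B)$ is not almost injective on the complement of its level sets of positive measure; and (ii) the restriction of $u$ to $u^{-1}(B)$ is almost countable to one on the complement of its level sets of positive measure. Then $u$ does not have a polar factorisation through $Y$.
   Context: $\lambda_n$ denotes $n$-dimensional Lebesgue measure and $\overline{\mathbb{R}}=\mathbb{R}\cup\{-\infty,+\infty\}$. A function $\psi:\mathbb{R}^n\to\overline{\mathbb{R}}$ is proper if it is not identically $+\infty$ and never takes the value $-\infty$. A finite complete measure space $(X,\mu)$ is a measure-interval if it is isomorphic to $[0,\mu(X)]$ with Lebesgue measure (on the Lebesgue sets): there exist sets of full measure $X'\subset X$, $I'\subset[0,\mu(X)]$ and a bijection $\tau:X'\to I'$ such that $\tau$ and $\tau^{-1}$ are measurable and measure-preserving. For finite measure spaces $(X,\mu)$, $(Y,\nu)$ with $\mu(X)=\nu(Y)$, functions $f\in L^1(X,\mu,\mathbb{R}^n)$ and $g\in L^1(Y,\nu,\mathbb{R}^n)$ are rearrangements of each other if $\mu(f^{-1}(B))=\nu(g^{-1}(B))$ for every Borel set $B\subset\mathbb{R}^n$. A measure-preserving mapping from $(X,\mu)$ to $(Y,\lambda_n)$ (with $\mu(X)=\lambda_n(Y)$)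 is a map $s:X\to Y$ with $\mu(s^{-1}(A))=\lambda_n(A)$ for every Borel (equivalently Lebesgue measurable) $A\subset Y$. For $u\in L^1(X,\mu,\mathbb{R}^n)$ with $(X,\mu)$ a measure-interval and $Y\subset\mathbb{R}^n$ Lebesgue measurable with $\lambda_n(Y)=\mu(X)$, the monotone rearrangement of $u$ on $Y$ is the (almost everywhere unique) function $u^{\#}:Y\to\mathbb{R}^n$ which is a rearrangement of $u$ and satisfies $u^{\#}=\nabla\psi$ a.e. in $Y$ for some proper lower semicontinuous convex $\psi:\mathbb{R}^n\to\overline{\mathbb{R}}$. We say $u$ has a polar factorisation through $Y$ if there is a measure-preserving mapping $s$ from $(X,\mu)$ to $(Y,\lambda_n)$ with $u=u^{\#}\circ s$ $\mu$-almost everywhere. For a map $f:U\to\mathbb{R}^n$ on a finite measure space $(U,\mu)$: a level set is a set $f^{-1}(a)$, $a\in\mathbb{R}^n$; the complement of its level sets of positive measure is $U_0=U\setminus\bigcup\{f^{-1}(a):\mu(f^{-1}(a))>0\}$. $f$ is almost injective if there is $U'\subset U$ with $\mu(U\setminus U')=0$ and $f|_{U'}$ injective; $f$ is almost countable to one if there is $U'$ of full measure such that every level set of $f$ has countable intersection with $U'$. A property "on the complement of its level sets of positive measure" means the property holds for the restriction $f|_{U_0}$ with respect to $\mu$ restricted to $U_0$. *)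

theory Defs
  imports "HOL-Analysis.Analysis"
begin

definition measure_interval :: "'a measure \<Rightarrow> bool" where
  "measure_interval M \<longleftrightarrow> complete_measure M \<and> finite_measure M \<and>
    (\<exists>X' I' (\<tau>::'a \<Rightarrow> real).
       X' \<in> sets M \<and> X' \<subseteq> space M \<and> space M - X' \<in> null_sets M \<and>
       I' \<in> sets lebesgue \<and> I' \<subseteq> {0..measure M (space M)} \<and>
       {0..measure M (space M)} - I' \<in> null_sets lebesgue \<and>
       bij_betw \<tau> X' I' \<and>
       (\<forall>A\<in>sets lebesgue. A \<subseteq> I' \<longrightarrow>
          \<tau> -` A \<inter> X' \<in> sets M \<and> emeasure M (\<tau> -` A \<inter> X') = emeasure lebesgue A) \<and>
       (\<forall>C\<in>sets M. C \<subseteq> X' \<longrightarrow>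
          \<tau> ` C \<in> sets lebesgue \<and> emeasure lebesgue (\<tau> ` C) = emeasure M C))"

definition is_rearrangement :: "'a measure \<Rightarrow> ('a \<Rightarrow> 'b::euclidean_space) \<Rightarrow> 'c measure \<Rightarrow> ('c \<Rightarrow> 'b) \<Rightarrow> bool" where
  "is_rearrangement M f N g \<longleftrightarrow> finite_measure M \<and> finite_measure N \<and>
     emeasure M (space M) = emeasure N (space N) \<and> integrable M f \<and> integrable N g \<and>
     (\<forall>B\<in>sets borel. emeasure M (f -` B \<inter> space M) = emeasure N (g -` B \<inter> space N))"

definition proper_lsc_convex :: "('b::euclidean_space \<Rightarrow> ereal) \<Rightarrow> bool" where
  "proper_lsc_convex \<psi> \<longleftrightarrow>
     (\<forall>x. \<psi> x \<noteq> -\<infinity>) \<and> (\<exists>x. \<psi> x \<noteq> \<infinity>) \<and>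
     (\<forall>x. \<psi> x \<le> Liminf (at x) \<psi>) \<and>
     (\<forall>x y t. 0 \<le> t \<and> t \<le> 1 \<longrightarrow>
        \<psi> ((1 - t) *\<^sub>R x + t *\<^sub>R y) \<le> ereal (1 - t) * \<psi> x + ereal t * \<psi> y)"

definition is_gradient_at :: "('b::euclidean_space \<Rightarrow> ereal) \<Rightarrow> 'b \<Rightarrow> 'b \<Rightarrow> bool" where
  "is_gradient_at \<psi> g y \<longleftrightarrow> (\<forall>\<^sub>F x in nhds y. \<bar>\<psi> x\<bar> \<noteq> \<infinity>) \<and>
     ((\<lambda>x. real_of_ereal (\<psi> x)) has_derivative (\<lambda>h. g \<bullet> h)) (at y)"

definition monotone_rearrangement :: "'a measure \<Rightarrow> ('a \<Rightarrow> 'b::euclidean_space) \<Rightarrow> 'b set \<Rightarrow> ('b \<Rightarrow> 'b) \<Rightarrow> bool" where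
  "monotone_rearrangement M u Y v \<longleftrightarrow>
     is_rearrangement M u (restrict_space lebesgue Y) v \<and>
     (\<exists>\<psi>. proper_lsc_convex \<psi> \<and> (AE y in lebesgue. y \<in> Y \<longrightarrow> is_gradient_at \<psi> (v y) y))"

definition measure_preserving_to :: "'a measure \<Rightarrow> 'b::euclidean_space set \<Rightarrow> ('a \<Rightarrow> 'b) \<Rightarrow> bool" where
  "measure_preserving_to M Y s \<longleftrightarrow> s \<in> space M \<rightarrow> Y \<and>
     (\<forall>A\<in>sets borel. A \<subseteq> Y \<longrightarrow>
        s -` A \<inter> space M \<in> sets M \<and> emeasure M (s -` A \<inter> space M) = emeasure lebesgue A)"

text \<open>u has a polar factorisation through Y, relative to the (a.e. unique) monotone rearrangement v.\<close>
definition has_polar_factorisation :: "'a measure \<Rightarrow> ('a \<Rightarrow> 'b::euclidean_space) \<Rightarrow> 'b set \<Rightarrow> ('b \<Rightarrow> 'b) \<Rightarrow> bool" where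
  "has_polar_factorisation M u Y v \<longleftrightarrow>
     (\<exists>s. measure_preserving_to M Y s \<and> (AE x in M. u x = v (s x)))"

definition pos_level_complement :: "'a measure \<Rightarrow> ('a \<Rightarrow> 'b) \<Rightarrow> 'a set" where
  "pos_level_complement N f =
     space N - \<Union>{f -` {a} \<inter> space N | a. emeasure N (f -` {a} \<inter> space N) > 0}"

definition almost_injective :: "'a measure \<Rightarrow> ('a \<Rightarrow> 'b) \<Rightarrow> bool" where
  "almost_injective N f \<longleftrightarrow> (\<exists>U'\<subseteq>space N. space N - U' \<in> null_sets N \<and> inj_on f U')"

definition almost_countable_to_one :: "'a measure \<Rightarrow> ('a \<Rightarrow> 'b) \<Rightarrow> bool" where
  "almost_countable_to_one N f \<longleftrightarrow>
     (\<exists>U'\<subseteq>space N. space N - U' \<in> null_sets N \<and> (\<forall>a. countable (f -` {a} \<inter> U')))"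

definition on_pos_level_complement ::
    "('a measure \<Rightarrow> ('a \<Rightarrow> 'b) \<Rightarrow> bool) \<Rightarrow> 'a measure \<Rightarrow> ('a \<Rightarrow> 'b) \<Rightarrow> bool" where
  "on_pos_level_complement P N f = P (restrict_space N (pos_level_complement N f)) f"

end

theory Submission
  imports Defs
begin

text \<open>
  Let \<open>u = v \<circ> s\<close> with \<open>v = \<nabla>\<psi>\<close>. Lusin's theorem, transported to \<open>X\<close> through the measure-interval
  structure, shows that every compact set of positive measure in the relevant part of \<open>Y\<close> contains
  a compact set \<open>F\<close> of positive measure inside the image under \<open>s\<close> of the set on which \<open>u\<close> is
  countable to one; hence \<open>v\<close> is countable to one on \<open>F\<close>. On the other hand, if \<open>v\<close> is not almost
  injective, then \<open>F\<close> can be chosen such that for some closed ball \<open>K\<close> disjoint from \<open>F\<close> every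
  \<open>v y\<close>, \<open>y \<in> F\<close>, is a subgradient of \<open>\<psi>\<close> at some point of \<open>K\<close>. Let \<open>w y\<close> be the point of least norm
  among these. The maps \<open>T t y = (1 - t) y + t w y\<close> move \<open>y\<close> inside the fibre of \<open>\<partial>\<psi>\<close> over \<open>v y\<close>, and
  they contract volume at most by the factor \<open>(1 - t) ^ n\<close>. So for all small \<open>t\<close> a set of positive
  measure of points of \<open>F\<close> is mapped back into \<open>F\<close>, and by Fubini some \<open>y \<in> F\<close> has uncountably many
  \<open>T t y\<close> in \<open>F\<close>, all of them in one level set of \<open>v\<close>.
\<close>

section \<open>Subgradients of convex functions\<close>

text \<open>Finiteness at \<open>y\<close> makes \<open>real_of_ereal\<close> faithful there. The
  inequality itself stays in \<open>ereal\<close>, so that points where \<open>\<psi>\<close> is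
  infinite satisfy it automatically.\<close>

definition is_subgradient_at :: "('b::euclidean_space \<Rightarrow> ereal) \<Rightarrow> 'b \<Rightarrow> 'b \<Rightarrow> bool" where
  "is_subgradient_at \<psi> b y \<longleftrightarrow>
     \<bar>\<psi> y\<bar> \<noteq> \<infinity> \<and> (\<forall>x. ereal (real_of_ereal (\<psi> y) + b \<bullet> (x - y)) \<le> \<psi> x)"

lemma is_subgradient_atD:
  assumes "is_subgradient_at \<psi> b y" and "\<bar>\<psi> x\<bar> \<noteq> \<infinity>"
  shows "real_of_ereal (\<psi> y) + b \<bullet> (x - y) \<le> real_of_ereal (\<psi> x)"
  using assms unfolding is_subgradient_at_def by (metis ereal_less_eq(3) ereal_real')

lemma is_subgradient_atI:
  assumes "\<And>x. \<psi> x \<noteq> -\<infinity>" and "\<bar>\<psi> y\<bar> \<noteq> \<infinity>"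
    and "\<And>x. \<bar>\<psi> x\<bar> \<noteq> \<infinity> \<Longrightarrow> real_of_ereal (\<psi> y) + b \<bullet> (x - y) \<le> real_of_ereal (\<psi> x)"
  shows "is_subgradient_at \<psi> b y"
  unfolding is_subgradient_at_def
proof (intro conjI allI)
  fix x
  show "ereal (real_of_ereal (\<psi> y) + b \<bullet> (x - y)) \<le> \<psi> x"
    using assms(1)[of x] assms(3)[of x] by (cases "\<psi> x") auto
qed (fact assms(2))

text \<open>Along the segment from \<open>y\<close> to \<open>x\<close>, convexity bounds the
  difference quotients by the difference of the values at the ends. As \<open>t\<close> decreases to
  0, they tend to the directional derivative \<open>g \<bullet> (x - y)\<close>.\<close>

lemma is_gradient_at_imp_subgradient:
  assumes \<psi>: "proper_lsc_convex \<psi>" and grad: "is_gradient_at \<psi> g y"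
  shows "is_subgradient_at \<psi> g y"
proof (rule is_subgradient_atI)
  show "\<psi> x \<noteq> -\<infinity>" for x
    using \<psi> by (simp add: proper_lsc_convex_def)
  have fin: "\<forall>\<^sub>F x in nhds y. \<bar>\<psi> x\<bar> \<noteq> \<infinity>"
    and der: "((\<lambda>x. real_of_ereal (\<psi> x)) has_derivative (\<lambda>h. g \<bullet> h)) (at y)"
    using grad by (auto simp: is_gradient_at_def)
  show finy: "\<bar>\<psi> y\<bar> \<noteq> \<infinity>"
    using fin by (rule eventually_nhds_x_imp_x)
  fix x assume finx: "\<bar>\<psi> x\<bar> \<noteq> \<infinity>"
  define f where "f t = y + t *\<^sub>R (x - y)" for t :: real
  define r where "r z = real_of_ereal (\<psi> z)" for z
  have "(f has_derivative (\<lambda>t. t *\<^sub>R (x - y))) (at 0)"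
    unfolding f_def by (auto intro!: derivative_eq_intros)
  then have "((\<lambda>t. r (f t)) has_derivative (\<lambda>t. g \<bullet> (t *\<^sub>R (x - y)))) (at 0)"
    using der has_derivative_compose[of f "\<lambda>t. t *\<^sub>R (x - y)" 0 UNIV r "\<lambda>h. g \<bullet> h"]
    unfolding r_def by (simp add: f_def)
  then have "((\<lambda>t. r (f t)) has_real_derivative g \<bullet> (x - y)) (at 0)"
    by (simp add: has_field_derivative_def mult_commute_abs)
  then have "((\<lambda>t. (r (f t) - r (f 0)) / t) \<longlongrightarrow> g \<bullet> (x - y)) (at 0)"
    by (simp add: DERIV_def)
  then have lim: "((\<lambda>t. (r (f t) - r y) / t) \<longlongrightarrow> g \<bullet> (x - y)) (at_right 0)"
    by (simp add: f_def filterlim_at_split)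
  have "(f \<longlongrightarrow> y) (at_right 0)"
    unfolding f_def by (auto intro!: tendsto_eq_intros)
  then have "\<forall>\<^sub>F t in at_right 0. \<bar>\<psi> (f t)\<bar> \<noteq> \<infinity>"
    using fin by (rule filterlim_iff[THEN iffD1, rule_format])
  moreover have "\<forall>\<^sub>F t in at_right 0. (0::real) < t"
    by (simp add: eventually_at_right_less)
  moreover have "\<forall>\<^sub>F t in at_right 0. t < (1::real)"
    by (rule eventually_at_right_real[THEN eventually_mono, of 0 1]) auto
  ultimately have "\<forall>\<^sub>F t in at_right 0. (r (f t) - r y) / t \<le> r x - r y"
  proof eventually_elim
    case (elim t)
    have "f t = (1 - t) *\<^sub>R y + t *\<^sub>R x"
      by (simp add: f_def algebra_simps)
    then have "\<psi> (f t) \<le> ereal (1 - t) * \<psi> y + ereal t * \<psi> x"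
      using \<psi> elim unfolding proper_lsc_convex_def by (simp add: less_imp_le)
    also have "\<dots> = ereal ((1 - t) * r y + t * r x)"
      using finx finy by (cases "\<psi> x"; cases "\<psi> y") (auto simp: r_def)
    finally have "r (f t) \<le> (1 - t) * r y + t * r x"
      using elim(1) by (cases "\<psi> (f t)") (auto simp: r_def)
    then show ?case
      using elim by (simp add: field_simps)
  qed
  with lim have "g \<bullet> (x - y) \<le> r x - r y"
    by (rule tendsto_upperbound) simp
  then show "real_of_ereal (\<psi> y) + g \<bullet> (x - y) \<le> real_of_ereal (\<psi> x)"
    by (simp add: r_def)
qed

text \<open>Subtracting the linear function with slope \<open>b\<close> leaves a function with a
  local minimum at \<open>y\<close>, so its derivative, given by \<open>g - b\<close>,
  vanishes.\<close>

lemma subgradient_eq_gradient: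
  assumes grad: "is_gradient_at \<psi> g y" and sub: "is_subgradient_at \<psi> b y"
  shows "b = g"
proof -
  have fin: "\<forall>\<^sub>F x in nhds y. \<bar>\<psi> x\<bar> \<noteq> \<infinity>"
    and der: "((\<lambda>x. real_of_ereal (\<psi> x)) has_derivative (\<lambda>h. g \<bullet> h)) (at y)"
    using grad by (auto simp: is_gradient_at_def)
  obtain S where S: "open S" "y \<in> S" "\<And>x. x \<in> S \<Longrightarrow> \<bar>\<psi> x\<bar> \<noteq> \<infinity>"
    using fin unfolding eventually_nhds by (elim exE conjE) (rule that, auto)
  have "(\<lambda>h. g \<bullet> h - b \<bullet> h) = (\<lambda>h. 0)"
  proof (rule differential_zero_maxmin[OF S(2,1)])
    show "((\<lambda>x. real_of_ereal (\<psi> x) - b \<bullet> x) has_derivative (\<lambda>h. g \<bullet> h - b \<bullet> h)) (at y)"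
      by (intro derivative_intros der)
    have "real_of_ereal (\<psi> y) - b \<bullet> y \<le> real_of_ereal (\<psi> x) - b \<bullet> x" if "x \<in> S" for x
      using is_subgradient_atD[OF sub S(3)[OF that]] by (simp add: inner_diff_right)
    then show "(\<forall>x\<in>S. real_of_ereal (\<psi> x) - b \<bullet> x \<le> real_of_ereal (\<psi> y) - b \<bullet> y) \<or>
        (\<forall>x\<in>S. real_of_ereal (\<psi> y) - b \<bullet> y \<le> real_of_ereal (\<psi> x) - b \<bullet> x)"
      by blast
  qed
  then have "g \<bullet> (g - b) - b \<bullet> (g - b) = 0"
    by metis
  then have "(g - b) \<bullet> (g - b) = 0"
    by (simp add: inner_diff_left)
  then show ?thesis by simp
qed

text \<open>Adding the two subgradient inequalities gives monotonicity. In the case of equality both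
  are equalities, so the affine support of slope \<open>b\<close> at \<open>y\<close> also touches
  \<open>\<psi>\<close> at \<open>y'\<close>.\<close>

lemma subgradient_monotone:
  assumes "is_subgradient_at \<psi> b y" "is_subgradient_at \<psi> b' y'"
  shows "0 \<le> (b - b') \<bullet> (y - y')"
    and "(b - b') \<bullet> (y - y') = 0 \<Longrightarrow> is_subgradient_at \<psi> b y'"
proof -
  have 1: "real_of_ereal (\<psi> y) + b \<bullet> (y' - y) \<le> real_of_ereal (\<psi> y')"
    and 2: "real_of_ereal (\<psi> y') + b' \<bullet> (y - y') \<le> real_of_ereal (\<psi> y)"
    using assms by (auto intro!: is_subgradient_atD simp: is_subgradient_at_def[of \<psi>])
  then show "0 \<le> (b - b') \<bullet> (y - y')"
    by (simp add: algebra_simps)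
  assume "(b - b') \<bullet> (y - y') = 0"
  with 1 2 have "real_of_ereal (\<psi> y') = real_of_ereal (\<psi> y) + b \<bullet> (y' - y)"
    by (simp add: algebra_simps)
  then have "real_of_ereal (\<psi> y') + b \<bullet> (x - y') = real_of_ereal (\<psi> y) + b \<bullet> (x - y)" for x
    by (simp add: algebra_simps)
  then show "is_subgradient_at \<psi> b y'"
    using assms by (simp add: is_subgradient_at_def)
qed

text \<open>The affine support of slope \<open>b\<close> at \<open>y\<close> touches
  \<open>\<psi>\<close> at \<open>z\<close> as well. Between the two points convexity bounds
  \<open>\<psi>\<close> above by this affine function, and the subgradient inequality bounds it
  below.\<close>

lemma subgradient_segment:
  assumes \<psi>: "proper_lsc_convex \<psi>"
    and y: "is_subgradient_at \<psi> b y" and z: "is_subgradient_at \<psi> b z"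
    and t: "0 \<le> t" "t \<le> 1"
  shows "is_subgradient_at \<psi> b ((1 - t) *\<^sub>R y + t *\<^sub>R z)"
proof -
  define x where "x = (1 - t) *\<^sub>R y + t *\<^sub>R z"
  have finy: "\<bar>\<psi> y\<bar> \<noteq> \<infinity>" and finz: "\<bar>\<psi> z\<bar> \<noteq> \<infinity>"
    using y z by (auto simp: is_subgradient_at_def)
  define r where "r x = real_of_ereal (\<psi> x)" for x
  have rz: "r z = r y + b \<bullet> (z - y)"
    using is_subgradient_atD[OF y finz] is_subgradient_atD[OF z finy]
    by (simp add: r_def algebra_simps)
  have xy: "x - y = t *\<^sub>R (z - y)"
    by (simp add: x_def algebra_simps)
  have "\<psi> x \<le> ereal (1 - t) * \<psi> y + ereal t * \<psi> z"
    using \<psi> t unfolding proper_lsc_convex_def x_def by simp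
  also have "\<dots> = ereal ((1 - t) * r y + t * r z)"
    using finy finz by (cases "\<psi> y"; cases "\<psi> z") (auto simp: r_def)
  also have "(1 - t) * r y + t * r z = r y + b \<bullet> (x - y)"
    unfolding xy rz by (simp add: algebra_simps)
  finally have le: "\<psi> x \<le> ereal (r y + b \<bullet> (x - y))" .
  moreover have ge: "ereal (r y + b \<bullet> (x - y)) \<le> \<psi> x"
    using y by (simp add: is_subgradient_at_def r_def)
  ultimately have eq: "\<psi> x = ereal (r y + b \<bullet> (x - y))"
    by (rule antisym)
  have "r y + b \<bullet> (x - y) + b \<bullet> (w - x) = r y + b \<bullet> (w - y)" for w
    by (simp add: algebra_simps)
  then show ?thesis
    using y eq unfolding is_subgradient_at_def x_def[symmetric] r_def
    by (simp only: real_of_ereal.simps) simp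
qed

section \<open>Limits of approximate subgradients\<close>

lemma lsc_sequentially_le:
  assumes \<psi>: "proper_lsc_convex \<psi>"
    and z: "z \<longlonglongrightarrow> l" and c: "c \<longlonglongrightarrow> d" and le: "\<And>n. \<psi> (z n) \<le> ereal (c n)"
  shows "\<psi> l \<le> ereal d"
proof (rule ccontr)
  assume "\<not> \<psi> l \<le> ereal d"
  then obtain r where r: "d < r" "ereal r < \<psi> l"
    by (metis ereal_dense2 linorder_not_le less_ereal.simps(1))
  have "ereal r < Liminf (at l) \<psi>"
    using \<psi> r(2) unfolding proper_lsc_convex_def by (meson less_le_trans)
  then have "\<forall>\<^sub>F x in at l. ereal r < \<psi> x"
    by (metis le_Liminf_iff order_refl)
  \<comment> \<open>The \<open>Liminf\<close> concerns punctured neighbourhoods only; the value at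
    \<open>l\<close> itself is supplied by the choice of \<open>r\<close>.\<close>
  then have "\<forall>\<^sub>F x in nhds l. ereal r < \<psi> x"
    using r(2) by (simp add: eventually_nhds_conv_at)
  then have "\<forall>\<^sub>F n in sequentially. ereal r < \<psi> (z n)"
    using z by (rule eventually_compose_filterlim)
  moreover have "\<forall>\<^sub>F n in sequentially. c n < r"
    using c r(1) by (rule order_tendstoD(2))
  ultimately have "\<forall>\<^sub>F n in sequentially. False"
  proof eventually_elim
    case (elim n)
    then show ?case using le[of n] by (metis ereal_less_eq(3) leD less_le_trans order_less_imp_le)
  qed
  then show False by simp
qed

text \<open>Solving the inequality for \<open>\<psi> (z n)\<close> gives an upper bound that
  converges, and lower semicontinuity carries it to \<open>l\<close>. The error \<open>e\<close>
  lets this serve both for exact subgradients and for approximate minimisers.\<close>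

lemma approximate_subgradient_limit:
  assumes \<psi>: "proper_lsc_convex \<psi>"
    and z: "z \<longlonglongrightarrow> l" and b: "b \<longlonglongrightarrow> b'" and e: "e \<longlonglongrightarrow> 0"
    and fin: "\<And>n. \<bar>\<psi> (z n)\<bar> \<noteq> \<infinity>"
    and le: "\<And>n x. \<bar>\<psi> x\<bar> \<noteq> \<infinity> \<Longrightarrow>
      real_of_ereal (\<psi> (z n)) + b n \<bullet> (x - z n) \<le> real_of_ereal (\<psi> x) + e n"
  shows "is_subgradient_at \<psi> b' l"
proof -
  have nm: "\<psi> x \<noteq> -\<infinity>" for x
    using \<psi> by (simp add: proper_lsc_convex_def)
  have key: "\<psi> l \<le> ereal (real_of_ereal (\<psi> x) - b' \<bullet> (x - l))" if x: "\<bar>\<psi> x\<bar> \<noteq> \<infinity>" for x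
  proof (rule lsc_sequentially_le[OF \<psi> z])
    show "(\<lambda>n. real_of_ereal (\<psi> x) + e n - b n \<bullet> (x - z n))
        \<longlonglongrightarrow> real_of_ereal (\<psi> x) - b' \<bullet> (x - l)"
      by (auto intro!: tendsto_eq_intros z b e)
    show "\<psi> (z n) \<le> ereal (real_of_ereal (\<psi> x) + e n - b n \<bullet> (x - z n))" for n
      using le[OF x, of n] fin[of n] by (cases "\<psi> (z n)") auto
  qed
  obtain x0 where "\<bar>\<psi> x0\<bar> \<noteq> \<infinity>"
    using fin[of 0] by (rule that)
  from key[OF this] have finl: "\<bar>\<psi> l\<bar> \<noteq> \<infinity>"
    using nm[of l] by auto
  show ?thesis
  proof (rule is_subgradient_atI)
    show "\<psi> x \<noteq> -\<infinity>" for x by (fact nm)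
    show "\<bar>\<psi> l\<bar> \<noteq> \<infinity>" by (fact finl)
    fix x assume "\<bar>\<psi> x\<bar> \<noteq> \<infinity>"
    from key[OF this] show "real_of_ereal (\<psi> l) + b' \<bullet> (x - l) \<le> real_of_ereal (\<psi> x)"
      using finl by (cases "\<psi> l") auto
  qed
qed

section \<open>Contractions along the fibres of a subdifferential\<close>

text \<open>It suffices to take near-minimisers for the slopes in a finite net of \<open>S\<close>:
  on the bounded set \<open>D\<close>, a small change of slope changes differences of the objective
  only slightly.\<close>

lemma finite_approximate_argmin:
  fixes \<phi> :: "'b::euclidean_space \<Rightarrow> real"
  assumes "bounded D" "D \<noteq> {}" and bdd: "bdd_below (\<phi> ` D)" and S: "compact S" and \<delta>: "0 < \<delta>"
  obtains Z where "finite Z" "Z \<subseteq> D" "Z \<noteq> {}"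
    "\<And>b z. b \<in> S \<Longrightarrow> z \<in> D \<Longrightarrow> \<exists>z'\<in>Z. \<phi> z' - b \<bullet> z' \<le> \<phi> z - b \<bullet> z + \<delta>"
proof -
  obtain C where C: "0 < C" "\<And>z. z \<in> D \<Longrightarrow> norm z \<le> C"
    using \<open>bounded D\<close> by (meson bounded_pos)
  obtain z0 where z0: "z0 \<in> D"
    using \<open>D \<noteq> {}\<close> by blast
  \<comment> \<open>Points of \<open>D\<close> differ by at most \<open>2 * C\<close>, so a change
    of slope by less than \<open>\<eta>\<close> costs at most \<open>\<delta> / 2\<close>. The other
    half of \<open>\<delta>\<close> pays for near-minimality.\<close>
  define \<eta> where "\<eta> = \<delta> / (4 * C)"
  have \<eta>: "0 < \<eta>"
    using \<delta> C by (simp add: \<eta>_def)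
  obtain k where k: "finite k" "k \<subseteq> S" "S \<subseteq> (\<Union>x\<in>k. ball x \<eta>)"
    using seq_compact_imp_totally_bounded[OF compact_imp_seq_compact[OF S], rule_format, OF \<eta>]
    by (elim exE conjE) (rule that)
  have "\<exists>z\<in>D. \<forall>z'\<in>D. \<phi> z - b \<bullet> z \<le> \<phi> z' - b \<bullet> z' + \<delta> / 2" for b
  proof -
    define h where "h z = \<phi> z - b \<bullet> z" for z
    obtain m where m: "\<And>z. z \<in> D \<Longrightarrow> m \<le> \<phi> z"
      using bdd by (auto simp: bdd_below_def)
    have "m - norm b * C \<le> h z" if "z \<in> D" for z
    proof -
      have "b \<bullet> z \<le> norm b * norm z" by (rule norm_cauchy_schwarz)
      also have "\<dots> \<le> norm b * C" by (intro mult_left_mono C that) simp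
      finally show ?thesis using m[OF that] by (simp add: h_def)
    qed
    then have bh: "bdd_below (h ` D)" by (auto simp: bdd_below_def)
    have "Inf (h ` D) < Inf (h ` D) + \<delta> / 2" using \<delta> by simp
    then have "\<exists>x\<in>h ` D. x < Inf (h ` D) + \<delta> / 2"
      using \<open>D \<noteq> {}\<close> by (intro cInf_lessD) auto
    then obtain z where z: "z \<in> D" "h z < Inf (h ` D) + \<delta> / 2"
      by (elim bexE imageE) (rule that, auto)
    have "h z \<le> h z' + \<delta> / 2" if "z' \<in> D" for z'
      using z(2) cInf_lower[of "h z'" "h ` D"] bh that by fastforce
    then show ?thesis using z(1) by (auto simp: h_def)
  qed
  then obtain \<zeta> where \<zeta>: "\<And>b. \<zeta> b \<in> D"
      "\<And>b z'. z' \<in> D \<Longrightarrow> \<phi> (\<zeta> b) - b \<bullet> \<zeta> b \<le> \<phi> z' - b \<bullet> z' + \<delta> / 2"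
    by metis
  \<comment> \<open>The point \<open>z0\<close> keeps the set nonempty even when the net is
    empty.\<close>
  show thesis
  proof (rule that[of "insert z0 (\<zeta> ` k)"])
    fix b z assume "b \<in> S" and z: "z \<in> D"
    then obtain b' where b': "b' \<in> k" "dist b' b < \<eta>"
      using k(3) by auto
    have "(b' - b) \<bullet> (\<zeta> b' - z) \<le> norm (b' - b) * norm (\<zeta> b' - z)"
      by (rule norm_cauchy_schwarz)
    also have "\<dots> \<le> \<eta> * (2 * C)"
      using b' C(2)[OF z] C(2)[OF \<zeta>(1)[of b']] norm_triangle_ineq4[of "\<zeta> b'" z] \<eta>
      by (intro mult_mono) (auto simp: dist_norm)
    also have "\<dots> = \<delta> / 2"
      using C by (simp add: \<eta>_def)
    finally have "\<phi> (\<zeta> b') - b \<bullet> \<zeta> b' \<le> \<phi> z - b \<bullet> z + \<delta>"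
      using \<zeta>(2)[OF z, of b'] by (simp add: algebra_simps)
    then show "\<exists>z'\<in>insert z0 (\<zeta> ` k). \<phi> z' - b \<bullet> z' \<le> \<phi> z - b \<bullet> z + \<delta>"
      using b' by blast
  qed (use k \<zeta> z0 in auto)
qed

text \<open>Candidates are added one at a time, each by a measurable comparison with the previous
  best. Since \<open>\<phi>\<close> need not be measurable, measurability of its composition with
  \<open>\<zeta>\<close> is carried through the induction.\<close>

lemma borel_measurable_argmin:
  fixes \<phi> :: "'b::euclidean_space \<Rightarrow> real"
  assumes "finite Z" "Z \<noteq> {}"
  shows "\<exists>\<zeta>\<in>borel_measurable borel. (\<lambda>b. \<phi> (\<zeta> b)) \<in> borel_measurable borel \<and>
    range \<zeta> \<subseteq> Z \<and> (\<forall>b. \<forall>z\<in>Z. \<phi> (\<zeta> b) - b \<bullet> \<zeta> b \<le> \<phi> z - b \<bullet> z)"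
  using assms
proof (induction Z rule: finite_ne_induct)
  case (singleton z)
  then show ?case by (intro bexI[of _ "\<lambda>_. z"]) auto
next
  case (insert z0 Z)
  then obtain \<zeta> where [measurable]: "\<zeta> \<in> borel_measurable borel"
      "(\<lambda>b. \<phi> (\<zeta> b)) \<in> borel_measurable borel"
    and Z: "range \<zeta> \<subseteq> Z"
    and opt: "\<And>b z. z \<in> Z \<Longrightarrow> \<phi> (\<zeta> b) - b \<bullet> \<zeta> b \<le> \<phi> z - b \<bullet> z"
    by blast
  define \<xi> where "\<xi> b = (if \<phi> z0 - b \<bullet> z0 \<le> \<phi> (\<zeta> b) - b \<bullet> \<zeta> b then z0 else \<zeta> b)" for b
  show ?case
  proof (intro bexI[of _ \<xi>] conjI allI ballI)
    show "\<xi> \<in> borel_measurable borel"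
      unfolding \<xi>_def by measurable
    have "(\<lambda>b. \<phi> (\<xi> b))
        = (\<lambda>b. if \<phi> z0 - b \<bullet> z0 \<le> \<phi> (\<zeta> b) - b \<bullet> \<zeta> b then \<phi> z0 else \<phi> (\<zeta> b))"
      by (auto simp: \<xi>_def)
    then show "(\<lambda>b. \<phi> (\<xi> b)) \<in> borel_measurable borel"
      by simp
    show "range \<xi> \<subseteq> insert z0 Z"
      using Z by (auto simp: \<xi>_def)
    show "\<phi> (\<xi> b) - b \<bullet> \<xi> b \<le> \<phi> z - b \<bullet> z" if "z \<in> insert z0 Z" for b z
      using that opt[of z b] by (auto simp: \<xi>_def)
  qed
qed

text \<open>
  The map \<open>y \<mapsto> (1 - t) y + t \<zeta> (v y)\<close> is injective because \<open>v\<close> is monotone in \<open>y\<close> and the minimiser \<open>\<zeta> b\<close> of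
  \<open>\<phi> z - b \<bullet> z\<close> is monotone in \<open>b\<close>; as \<open>\<zeta>\<close> has finitely many values, the map is piecewise a homothety.
\<close>
lemma emeasure_contraction_argmin:
  fixes v :: "'b::euclidean_space \<Rightarrow> 'b" and \<phi> :: "'b \<Rightarrow> real"
  assumes F[measurable]: "F \<in> sets borel" and v[measurable]: "v \<in> borel_measurable borel"
    and mono: "\<And>y y'. y \<in> F \<Longrightarrow> y' \<in> F \<Longrightarrow> 0 \<le> (v y - v y') \<bullet> (y - y')"
    and strict: "\<And>y y'. y \<in> F \<Longrightarrow> y' \<in> F \<Longrightarrow> (v y - v y') \<bullet> (y - y') = 0 \<Longrightarrow> v y = v y'"
    and Z: "finite Z" and \<zeta>[measurable]: "\<zeta> \<in> borel_measurable borel" and ran: "range \<zeta> \<subseteq> Z"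
    and opt: "\<And>b z. z \<in> Z \<Longrightarrow> \<phi> (\<zeta> b) - b \<bullet> \<zeta> b \<le> \<phi> z - b \<bullet> z"
    and t: "0 \<le> t" "t < 1" and U[measurable]: "U \<in> sets borel"
  shows "ennreal ((1 - t) ^ DIM('b)) * emeasure lborel {y\<in>F. (1 - t) *\<^sub>R y + t *\<^sub>R \<zeta> (v y) \<in> U}
    \<le> emeasure lborel U"
proof -
  define T where "T y = (1 - t) *\<^sub>R y + t *\<^sub>R \<zeta> (v y)" for y
  have inj: "inj_on T F"
  proof (rule inj_onI)
    fix y y' assume y: "y \<in> F" "y' \<in> F" and eq: "T y = T y'"
    have *: "(1 - t) *\<^sub>R (y - y') = - (t *\<^sub>R (\<zeta> (v y) - \<zeta> (v y')))"
      using eq by (simp add: T_def algebra_simps add_eq_0_iff)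
    \<comment> \<open>Pairing the displacement with \<open>v y - v y'\<close> gives a nonnegative
      quantity by monotonicity of \<open>v\<close> and a nonpositive one by optimality of
      \<open>\<zeta>\<close>. Both are therefore zero, which forces equal gradients, then equal
      \<open>\<zeta>\<close>-values, then \<open>y = y'\<close>.\<close>
    have "(1 - t) * ((v y - v y') \<bullet> (y - y')) = (v y - v y') \<bullet> ((1 - t) *\<^sub>R (y - y'))"
      by simp
    also have "\<dots> = - t * ((v y - v y') \<bullet> (\<zeta> (v y) - \<zeta> (v y')))"
      unfolding * by simp
    also have "\<dots> \<le> 0"
    proof -
      have "0 \<le> (v y - v y') \<bullet> (\<zeta> (v y) - \<zeta> (v y'))"
        using opt[of "\<zeta> (v y)" "v y'"] opt[of "\<zeta> (v y')" "v y"] ran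
        by (force simp: algebra_simps)
      then show ?thesis using t by simp
    qed
    finally have "(v y - v y') \<bullet> (y - y') \<le> 0"
      using t by (simp add: mult_le_0_iff)
    then have "v y = v y'"
      using mono[OF y] strict[OF y] by simp
    then show "y = y'"
      using * t by simp
  qed
  \<comment> \<open>On each piece \<open>T\<close> is the homothety of ratio \<open>1 - t\<close>
    given by the constant value \<open>z\<close>, so its effect on volume is exact.\<close>
  define E where "E z = {y\<in>F. \<zeta> (v y) = z \<and> T y \<in> U}" for z
  have [measurable]: "T \<in> borel_measurable borel"
    unfolding T_def by measurable
  have E[measurable]: "E z \<in> sets borel" for z
    unfolding E_def by measurable
  have TE: "T ` E z = (\<lambda>y. (1 - t) *\<^sub>R y + t *\<^sub>R z) ` E z" for z
    by (intro image_cong) (auto simp: E_def T_def)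
  have TEb: "T ` E z \<in> sets borel" for z
  proof -
    have "T ` E z = (\<lambda>x. (1 / (1 - t)) *\<^sub>R (x - t *\<^sub>R z)) -` E z"
    proof (intro set_eqI iffI)
      fix x assume "x \<in> T ` E z"
      then obtain y where "y \<in> E z" "x = (1 - t) *\<^sub>R y + t *\<^sub>R z"
        unfolding TE by blast
      then show "x \<in> (\<lambda>x. (1 / (1 - t)) *\<^sub>R (x - t *\<^sub>R z)) -` E z"
        using t by simp
    next
      fix x assume "x \<in> (\<lambda>x. (1 / (1 - t)) *\<^sub>R (x - t *\<^sub>R z)) -` E z"
      then show "x \<in> T ` E z"
        unfolding TE using t
        by (intro image_eqI[of _ _ "(1 / (1 - t)) *\<^sub>R (x - t *\<^sub>R z)"]) auto
    qed
    then show ?thesis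
      using measurable_sets[of "\<lambda>x. (1 / (1 - t)) *\<^sub>R (x - t *\<^sub>R z)" borel borel "E z"]
      by simp
  qed
  have vol: "emeasure lborel (T ` E z) = ennreal ((1 - t) ^ DIM('b)) * emeasure lborel (E z)" for z
    using emeasure_lebesgue_affine[of "1 - t" "t *\<^sub>R z" "E z"] t TEb[of z] E[of z]
    by (simp add: TE[symmetric] ennreal_power)
  have "{y\<in>F. T y \<in> U} = (\<Union>z\<in>Z. E z)"
    using ran by (auto simp: E_def)
  then have "ennreal ((1 - t) ^ DIM('b)) * emeasure lborel {y\<in>F. T y \<in> U}
      = ennreal ((1 - t) ^ DIM('b)) * (\<Sum>z\<in>Z. emeasure lborel (E z))"
    using Z by (subst sum_emeasure) (auto simp: E_def disjoint_family_on_def)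
  also have "\<dots> = (\<Sum>z\<in>Z. emeasure lborel (T ` E z))"
    by (simp add: vol sum_distrib_left)
  \<comment> \<open>Injectivity of \<open>T\<close> keeps the images of the pieces disjoint, so
    their volumes add up inside \<open>U\<close>.\<close>
  also have "\<dots> = emeasure lborel (\<Union>z\<in>Z. T ` E z)"
  proof (rule sum_emeasure)
    show "disjoint_family_on (\<lambda>z. T ` E z) Z"
      unfolding disjoint_family_on_def
    proof (intro ballI impI)
      fix z z' :: 'b assume "z \<noteq> z'"
      then have "E z \<inter> E z' = {}" by (auto simp: E_def)
      moreover have "E z \<subseteq> F" "E z' \<subseteq> F" by (auto simp: E_def)
      ultimately show "T ` E z \<inter> T ` E z' = {}"
        using inj_on_image_Int[OF inj, of "E z" "E z'"] by auto
    qed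
  qed (use Z TEb in auto)
  also have "\<dots> \<le> emeasure lborel U"
    by (intro emeasure_mono) (auto simp: E_def)
  finally show ?thesis by (simp add: T_def)
qed

text \<open>As \<open>U\<close> is open, a point whose limit image lies in \<open>U\<close> has all
  but finitely many approximate images in \<open>U\<close>. The set in question thus lies in the
  increasing union of the sets \<open>A k\<close>, and measure is continuous from below.\<close>

lemma emeasure_contraction_limit:
  fixes w :: "'b::euclidean_space \<Rightarrow> 'b"
  assumes F[measurable]: "F \<in> sets borel" and w'[measurable]: "\<And>m. w' m \<in> borel_measurable borel"
    and lim: "\<And>y. y \<in> F \<Longrightarrow> (\<lambda>m. w' m y) \<longlonglongrightarrow> w y"
    and U: "open U"
    and le: "\<And>m. c * emeasure lborel {y\<in>F. (1 - t) *\<^sub>R y + t *\<^sub>R w' m y \<in> U} \<le> a"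
  shows "c * emeasure lborel {y\<in>F. (1 - t) *\<^sub>R y + t *\<^sub>R w y \<in> U} \<le> a"
proof -
  have [measurable]: "U \<in> sets borel"
    using U by simp
  define E where "E m = {y\<in>F. (1 - t) *\<^sub>R y + t *\<^sub>R w' m y \<in> U}" for m
  have E[measurable]: "E m \<in> sets borel" for m
    unfolding E_def by measurable
  define A where "A k = (\<Inter>m\<in>{k..}. E m)" for k
  have A[measurable]: "A k \<in> sets borel" for k
    unfolding A_def by (intro sets.countable_INT') auto
  have "{y\<in>F. (1 - t) *\<^sub>R y + t *\<^sub>R w y \<in> U} \<subseteq> (\<Union>k. A k)"
  proof safe
    fix y assume y: "y \<in> F" "(1 - t) *\<^sub>R y + t *\<^sub>R w y \<in> U"
    have "(\<lambda>m. (1 - t) *\<^sub>R y + t *\<^sub>R w' m y) \<longlonglongrightarrow> (1 - t) *\<^sub>R y + t *\<^sub>R w y"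
      by (intro tendsto_intros lim y)
    then have "\<forall>\<^sub>F m in sequentially. (1 - t) *\<^sub>R y + t *\<^sub>R w' m y \<in> U"
      using U y(2) by (rule topological_tendstoD)
    then show "y \<in> (\<Union>k. A k)"
      using y(1) by (auto simp: eventually_sequentially A_def E_def)
  qed
  then have "c * emeasure lborel {y\<in>F. (1 - t) *\<^sub>R y + t *\<^sub>R w y \<in> U}
      \<le> c * emeasure lborel (\<Union>k. A k)"
    by (intro mult_left_mono emeasure_mono) auto
  also have "emeasure lborel (\<Union>k. A k) = (SUP k. emeasure lborel (A k))"
    by (rule SUP_emeasure_incseq[symmetric]) (auto simp: incseq_def A_def)
  also have "c * \<dots> = (SUP k. c * emeasure lborel (A k))"
    by (rule SUP_mult_left_ennreal)
  also have "\<dots> \<le> a"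
  proof (rule SUP_least)
    fix k
    have "c * emeasure lborel (A k) \<le> c * emeasure lborel (E k)"
      by (intro mult_left_mono emeasure_mono) (auto simp: A_def)
    also have "\<dots> \<le> a" using le[of k] by (simp add: E_def)
    finally show "c * emeasure lborel (A k) \<le> a" .
  qed
  finally show ?thesis .
qed

section \<open>Measurable selection of the preimage point of least norm\<close>

text \<open>Otherwise a subsequence stays at distance at least \<open>e\<close> from
  \<open>a\<close>, while compactness gives it a convergent further subsequence, whose limit must be
  \<open>a\<close>.\<close>

lemma compact_unique_limit_point_LIMSEQ:
  fixes z :: "nat \<Rightarrow> 'a::metric_space"
  assumes K: "compact K" and z: "\<And>n. z n \<in> K"
    and uniq: "\<And>r l. strict_mono r \<Longrightarrow> (\<lambda>n. z (r n)) \<longlonglongrightarrow> l \<Longrightarrow> l = a"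
  shows "z \<longlonglongrightarrow> a"
proof (rule ccontr)
  assume "\<not> z \<longlonglongrightarrow> a"
  then obtain e where e: "0 < e" "\<forall>N. \<exists>n\<ge>N. e \<le> dist (z n) a"
    unfolding lim_sequentially not_all not_ex not_less by (auto simp: not_less)
  then have "infinite {n. e \<le> dist (z n) a}"
    unfolding infinite_nat_iff_unbounded_le by simp
  from infinite_enumerate[OF this] obtain r :: "nat \<Rightarrow> nat"
    where "strict_mono r" "\<forall>n. r n \<in> {n. e \<le> dist (z n) a}"
    by blast
  then have r: "strict_mono r" "\<And>n. e \<le> dist (z (r n)) a"
    by simp_all
  have "\<forall>n. z (r n) \<in> K"
    using z by simp
  then obtain l and q :: "nat \<Rightarrow> nat" where q: "strict_mono q" "(\<lambda>n. z (r (q n))) \<longlonglongrightarrow> l"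
    using K[unfolded compact_def, rule_format, of "\<lambda>n. z (r n)"] unfolding o_def by blast
  have "l = a"
    using uniq[of "\<lambda>n. r (q n)" l] q r(1) by (auto simp: strict_mono_def)
  then have "(\<lambda>n. dist (z (r (q n))) a) \<longlonglongrightarrow> 0"
    using q(2) tendsto_dist_iff[THEN iffD1] by simp
  moreover have "\<forall>n\<ge>0. e \<le> dist (z (r (q n))) a"
    using r(2) by simp
  ultimately have "e \<le> 0"
    by (intro LIMSEQ_le_const) auto
  then show False using e(1) by simp
qed

text \<open>The selection \<open>w\<close> is a pointwise limit of finitely valued minimisers
  composed with \<open>v\<close>. This gives its measurability, and lets the contraction estimate
  pass from the piecewise homotheties to the limit.\<close>

lemma subgradient_preimage_contraction:
  fixes \<psi> :: "'b::euclidean_space \<Rightarrow> ereal" and v :: "'b \<Rightarrow> 'b"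
  assumes \<psi>: "proper_lsc_convex \<psi>"
    and F[measurable]: "F \<in> sets borel" and "F \<noteq> {}" and v[measurable]: "v \<in> borel_measurable borel"
    and S: "compact S" "v ` F \<subseteq> S"
    and grad: "\<forall>y\<in>F. is_gradient_at \<psi> (v y) y"
    and K: "compact K" "convex K"
    and meet: "\<forall>y\<in>F. \<exists>z\<in>K. is_subgradient_at \<psi> (v y) z"
  shows "\<exists>w\<in>borel_measurable borel.
    (\<forall>y\<in>F. w y \<in> K \<and> is_subgradient_at \<psi> (v y) (w y)) \<and>
    (\<forall>t U. 0 \<le> t \<and> t < 1 \<and> open U \<longrightarrow>
       ennreal ((1 - t) ^ DIM('b)) * emeasure lborel {y\<in>F. (1 - t) *\<^sub>R y + t *\<^sub>R w y \<in> U}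
         \<le> emeasure lborel U)"
proof -
  note grad = grad[rule_format] and meet = meet[rule_format]
  have sub: "is_subgradient_at \<psi> (v y) y" if "y \<in> F" for y
    using is_gradient_at_imp_subgradient[OF \<psi> grad[OF that]] .
  define r where "r x = real_of_ereal (\<psi> x)" for x
  \<comment> \<open>Minimisation is restricted to points with finite \<open>\<psi>\<close>, because
    \<open>real_of_ereal\<close> would assign the spurious value 0 at infinity.\<close>
  define D where "D = {z\<in>K. \<bar>\<psi> z\<bar> \<noteq> \<infinity>}"
  define \<epsilon> where "\<epsilon> m = 1 / real (Suc m)" for m
  have \<epsilon>: "0 < \<epsilon> m" for m by (simp add: \<epsilon>_def)
  have \<epsilon>0: "\<epsilon> \<longlonglongrightarrow> 0" unfolding \<epsilon>_def by (rule LIMSEQ_Suc[OF lim_1_over_n])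
  \<comment> \<open>The quadratic term makes the approximate minimisers converge to the minimiser of least norm.\<close>
  define \<phi> where "\<phi> m z = r z + \<epsilon> m * (z \<bullet> z)" for m z
  obtain y0 where y0: "y0 \<in> F" using \<open>F \<noteq> {}\<close> by blast
  obtain C where C: "\<And>z. z \<in> K \<Longrightarrow> norm z \<le> C"
    using K(1) by (meson bounded_iff compact_imp_bounded)
  have bD: "bounded D" using K(1) by (auto simp: D_def intro: bounded_subset compact_imp_bounded)
  have neD: "D \<noteq> {}" using meet[OF y0] by (auto simp: D_def is_subgradient_at_def)
  have bdd: "bdd_below (\<phi> m ` D)" for m
  proof -
    \<comment> \<open>The affine support at \<open>y0\<close> is bounded below on the bounded set
      \<open>K\<close>, and the quadratic term is nonnegative.\<close>
    have "r y0 - v y0 \<bullet> y0 - norm (v y0) * C \<le> \<phi> m z" if z: "z \<in> D" for z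
    proof -
      have "- (v y0 \<bullet> z) \<le> norm (v y0) * norm z"
        using norm_cauchy_schwarz[of "- v y0" z] by simp
      also have "\<dots> \<le> norm (v y0) * C"
        using z C by (intro mult_left_mono) (auto simp: D_def)
      finally have "- (v y0 \<bullet> z) \<le> norm (v y0) * C" .
      moreover have "r y0 + v y0 \<bullet> (z - y0) \<le> r z"
        using is_subgradient_atD[OF sub[OF y0]] z by (simp add: D_def r_def)
      moreover have "0 \<le> \<epsilon> m * (z \<bullet> z)"
        using \<epsilon>[of m] by simp
      ultimately show ?thesis
        by (simp add: \<phi>_def algebra_simps)
    qed
    then show ?thesis by (auto simp: bdd_below_def)
  qed
  \<comment> \<open>The tolerance is the square of \<open>\<epsilon> m\<close>, hence of smaller
    order than the quadratic penalty: after division by \<open>\<epsilon> m\<close> an error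
    \<open>\<epsilon> m\<close> remains, which still vanishes in the limit.\<close>
  define P where "P m \<zeta> Z \<longleftrightarrow> finite Z \<and> Z \<subseteq> D \<and> \<zeta> \<in> borel_measurable borel \<and> range \<zeta> \<subseteq> Z \<and>
      (\<forall>b. \<forall>z\<in>Z. \<phi> m (\<zeta> b) - b \<bullet> \<zeta> b \<le> \<phi> m z - b \<bullet> z) \<and>
      (\<forall>b\<in>S. \<forall>z\<in>D. \<exists>z'\<in>Z. \<phi> m z' - b \<bullet> z' \<le> \<phi> m z - b \<bullet> z + (\<epsilon> m)\<^sup>2)" for m \<zeta> Z
  have "\<exists>p. P m (fst p) (snd p)" for m
  proof -
    obtain Z where Z: "finite Z" "Z \<subseteq> D" "Z \<noteq> {}"
      "\<And>b z. b \<in> S \<Longrightarrow> z \<in> D \<Longrightarrow> \<exists>z'\<in>Z. \<phi> m z' - b \<bullet> z' \<le> \<phi> m z - b \<bullet> z + (\<epsilon> m)\<^sup>2"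
      by (rule finite_approximate_argmin[OF bD neD bdd S(1), of "(\<epsilon> m)\<^sup>2"]) (use \<epsilon>[of m] in auto)
    obtain \<zeta> where "\<zeta> \<in> borel_measurable borel" "range \<zeta> \<subseteq> Z"
      "\<forall>b. \<forall>z\<in>Z. \<phi> m (\<zeta> b) - b \<bullet> \<zeta> b \<le> \<phi> m z - b \<bullet> z"
      using borel_measurable_argmin[OF Z(1,3), of "\<phi> m"] by (elim bexE conjE) (rule that)
    with Z have "P m \<zeta> Z"
      by (simp add: P_def)
    then show ?thesis by (intro exI[of _ "(\<zeta>, Z)"]) simp
  qed
  then obtain p where p: "\<And>m. P m (fst (p m)) (snd (p m))"
    by metis
  define \<zeta> where "\<zeta> m = fst (p m)" for m
  define Z where "Z m = snd (p m)" for m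
  have Z: "finite (Z m)" "Z m \<subseteq> D"
    and \<zeta>[measurable]: "\<zeta> m \<in> borel_measurable borel" and ran: "range (\<zeta> m) \<subseteq> Z m" for m
    using p[of m] by (auto simp: P_def \<zeta>_def Z_def)
  have opt: "\<phi> m (\<zeta> m b) - b \<bullet> \<zeta> m b \<le> \<phi> m z - b \<bullet> z" if "z \<in> Z m" for m b z
    using p[of m] that by (simp add: P_def \<zeta>_def Z_def)
  have net: "\<exists>z'\<in>Z m. \<phi> m z' - b \<bullet> z' \<le> \<phi> m z - b \<bullet> z + (\<epsilon> m)\<^sup>2" if "b \<in> S" "z \<in> D" for m b z
    using p[of m] that by (simp add: P_def \<zeta>_def Z_def)
  \<comment> \<open>The points of \<open>K\<close> at which \<open>v y\<close> is a subgradient form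
    a nonempty closed convex set, so its point nearest to the origin is unique. The value 0 off
    \<open>F\<close> makes \<open>w\<close> a limit of measurable functions on the whole
    space.\<close>
  define w where "w y = (if y \<in> F then
      closest_point {z\<in>K. is_subgradient_at \<psi> (v y) z} 0 else 0)" for y
  have w: "w y \<in> K \<and> is_subgradient_at \<psi> (v y) (w y) \<and> (\<lambda>m. \<zeta> m (v y)) \<longlonglongrightarrow> w y" if y: "y \<in> F" for y
  proof -
    define b where "b = v y"
    define A where "A = {z\<in>K. is_subgradient_at \<psi> b z}"
    have wA: "w y = closest_point A 0"
      using y by (simp add: w_def A_def b_def)
    have "closed A"
      unfolding closed_sequential_limits
    proof (intro allI impI, elim conjE)
      fix x l assume x: "\<forall>n. x n \<in> A" and l: "x \<longlonglongrightarrow> l"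
      have "l \<in> K"
        using x by (intro closed_sequentially[OF compact_imp_closed[OF K(1)] _ l]) (simp add: A_def)
      moreover have "is_subgradient_at \<psi> b l"
      proof (rule approximate_subgradient_limit[OF \<psi> l, of "\<lambda>_. b" _ "\<lambda>_. 0"])
        show "\<bar>\<psi> (x n)\<bar> \<noteq> \<infinity>" for n
          using x by (simp add: A_def is_subgradient_at_def)
        show "real_of_ereal (\<psi> (x n)) + b \<bullet> (p - x n) \<le> real_of_ereal (\<psi> p) + 0"
          if "\<bar>\<psi> p\<bar> \<noteq> \<infinity>" for n p
          using is_subgradient_atD[of \<psi> b "x n", OF _ that] x by (simp add: A_def)
      qed auto
      ultimately show "l \<in> A" by (simp add: A_def)
    qed
    moreover have "convex A"
      unfolding convex_alt A_def
      using K(2) subgradient_segment[OF \<psi>] by (auto simp: convex_alt)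
    moreover have "A \<noteq> {}"
      using meet[OF y] by (auto simp: A_def b_def)
    ultimately have inA: "w y \<in> A"
      and near: "\<And>z. z \<in> A \<Longrightarrow> norm (w y) \<le> norm z"
      and uniq: "\<And>z. z \<in> A \<Longrightarrow> norm z \<le> norm (w y) \<Longrightarrow> z = w y"
    proof -
      assume A: "closed A" "convex A" "A \<noteq> {}"
      show inA: "w y \<in> A"
        unfolding wA using A(1,3) by (rule closest_point_in_set)
      show near: "norm (w y) \<le> norm z" if "z \<in> A" for z
        using closest_point_le[OF A(1) that, of 0] by (simp add: wA)
      show "z = w y" if "z \<in> A" "norm z \<le> norm (w y)" for z
        using any_closest_point_unique[OF A(2,1) that(1) inA, of 0] near that(2)
        by (auto intro: order_trans)
    qed
    have bS: "b \<in> S" using S(2) y by (auto simp: b_def)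
    define a where "a = w y"
    have a: "is_subgradient_at \<psi> b a" "a \<in> D"
      using inA by (auto simp: a_def A_def D_def is_subgradient_at_def)
    have \<zeta>D: "\<zeta> m b \<in> D" for m using ran Z(2) by blast
    \<comment> \<open>\<open>Z m\<close> contains a point nearly as good as \<open>a\<close>, and
      \<open>\<zeta> m b\<close> is optimal within \<open>Z m\<close>.\<close>
    have le: "\<phi> m (\<zeta> m b) - b \<bullet> \<zeta> m b \<le> \<phi> m a - b \<bullet> a + (\<epsilon> m)\<^sup>2" for m
      using net[OF bS a(2), of m] opt[of _ m b] by (meson order_trans)
    have "(\<lambda>m. \<zeta> m b) \<longlonglongrightarrow> a"
    proof (rule compact_unique_limit_point_LIMSEQ[OF K(1)])
      show "\<zeta> m b \<in> K" for m using \<zeta>D by (simp add: D_def)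
      fix q l assume q: "strict_mono (q :: nat \<Rightarrow> nat)" and l: "(\<lambda>n. \<zeta> (q n) b) \<longlonglongrightarrow> l"
      have \<epsilon>q: "(\<lambda>n. \<epsilon> (q n)) \<longlonglongrightarrow> 0"
        using LIMSEQ_subseq_LIMSEQ[OF \<epsilon>0 q] by (simp add: o_def)
      have "l \<in> K"
        using \<zeta>D by (intro closed_sequentially[OF compact_imp_closed[OF K(1)] _ l]) (simp add: D_def)
      \<comment> \<open>The nonnegative penalty at the minimiser is dropped; what remains is an
        approximate subgradient inequality with vanishing error.\<close>
      moreover have "is_subgradient_at \<psi> b l"
      proof (rule approximate_subgradient_limit[OF \<psi> l, of "\<lambda>_. b" _
            "\<lambda>n. \<epsilon> (q n) * (a \<bullet> a) + (\<epsilon> (q n))\<^sup>2"])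
        show "(\<lambda>n. \<epsilon> (q n) * (a \<bullet> a) + (\<epsilon> (q n))\<^sup>2) \<longlonglongrightarrow> 0"
          by (auto intro!: tendsto_eq_intros \<epsilon>q)
        show "\<bar>\<psi> (\<zeta> (q n) b)\<bar> \<noteq> \<infinity>" for n
          using \<zeta>D by (simp add: D_def)
        show "real_of_ereal (\<psi> (\<zeta> (q n) b)) + b \<bullet> (x - \<zeta> (q n) b)
            \<le> real_of_ereal (\<psi> x) + (\<epsilon> (q n) * (a \<bullet> a) + (\<epsilon> (q n))\<^sup>2)"
          if "\<bar>\<psi> x\<bar> \<noteq> \<infinity>" for n x
        proof -
          have "0 \<le> \<epsilon> (q n) * (\<zeta> (q n) b \<bullet> \<zeta> (q n) b)" using \<epsilon>[of "q n"] by simp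
          then show ?thesis
            using le[of "q n"] is_subgradient_atD[OF a(1) that] by (simp add: \<phi>_def r_def inner_diff_right)
        qed
      qed auto
      ultimately have "l \<in> A" by (simp add: A_def)
      \<comment> \<open>The exact subgradient inequality at \<open>a\<close> cancels the main terms.
        Division by \<open>\<epsilon> (q n)\<close> compares the squared norms, so \<open>l\<close>
        has norm at most that of \<open>a\<close> and equals it by uniqueness.\<close>
      have "\<zeta> (q n) b \<bullet> \<zeta> (q n) b \<le> a \<bullet> a + \<epsilon> (q n)" for n
      proof -
        have "r a + b \<bullet> (\<zeta> (q n) b - a) \<le> r (\<zeta> (q n) b)"
          using is_subgradient_atD[OF a(1), of "\<zeta> (q n) b"] \<zeta>D[of "q n"] by (simp add: D_def r_def)
        then have "\<epsilon> (q n) * (\<zeta> (q n) b \<bullet> \<zeta> (q n) b) \<le> \<epsilon> (q n) * (a \<bullet> a + \<epsilon> (q n))"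
          using le[of "q n"] by (simp add: \<phi>_def algebra_simps power2_eq_square)
        then show ?thesis using \<epsilon>[of "q n"] by simp
      qed
      moreover have "(\<lambda>n. \<zeta> (q n) b \<bullet> \<zeta> (q n) b) \<longlonglongrightarrow> l \<bullet> l"
        by (intro tendsto_intros l)
      moreover have "(\<lambda>n. a \<bullet> a + \<epsilon> (q n)) \<longlonglongrightarrow> a \<bullet> a"
        by (auto intro!: tendsto_eq_intros \<epsilon>q)
      ultimately have "l \<bullet> l \<le> a \<bullet> a"
        by (intro LIMSEQ_le[of _ "l \<bullet> l" _ "a \<bullet> a"]) auto
      then have "norm l \<le> norm (w y)"
        by (simp add: norm_eq_sqrt_inner a_def)
      then show "l = a"
        using uniq[OF \<open>l \<in> A\<close>] by (simp add: a_def)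
    qed
    then show ?thesis
      using inA by (simp add: A_def a_def b_def)
  qed
  show ?thesis
  proof (intro bexI[of _ w] conjI ballI allI impI)
    have "(\<lambda>m. if y \<in> F then \<zeta> m (v y) else 0) \<longlonglongrightarrow> w y" for y
      using w[of y] by (simp add: w_def)
    then show "w \<in> borel_measurable borel"
      by (rule borel_measurable_LIMSEQ_metric[rotated]) measurable
    show "w y \<in> K" "is_subgradient_at \<psi> (v y) (w y)" if "y \<in> F" for y
      using w[OF that] by simp_all
    fix t :: real and U :: "'b set"
    assume tU: "0 \<le> t \<and> t < 1 \<and> open U"
    then have t: "0 \<le> t" "t < 1" and U: "open U"
      by simp_all
    show "ennreal ((1 - t) ^ DIM('b)) * emeasure lborel {y\<in>F. (1 - t) *\<^sub>R y + t *\<^sub>R w y \<in> U}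
         \<le> emeasure lborel U"
    proof (rule emeasure_contraction_limit[OF F, where w' = "\<lambda>m y. \<zeta> m (v y)"])
      show "(\<lambda>m. \<zeta> m (v y)) \<longlonglongrightarrow> w y" if "y \<in> F" for y
        using w[OF that] by blast
      show "ennreal ((1 - t) ^ DIM('b)) *
          emeasure lborel {y\<in>F. (1 - t) *\<^sub>R y + t *\<^sub>R \<zeta> m (v y) \<in> U} \<le> emeasure lborel U" for m
      proof (rule emeasure_contraction_argmin[OF F v _ _ Z(1) \<zeta> ran opt t])
        show "0 \<le> (v y - v y') \<bullet> (y - y')" if "y \<in> F" "y' \<in> F" for y y'
          using subgradient_monotone(1)[OF sub[OF that(1)] sub[OF that(2)]] .
        \<comment> \<open>In the case of equality \<open>v y\<close> is also a subgradient at
          \<open>y'\<close>, where the gradient is the only one.\<close>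
        show "v y = v y'" if "y \<in> F" "y' \<in> F" "(v y - v y') \<bullet> (y - y') = 0" for y y'
          using subgradient_monotone(2)[OF sub[OF that(1)] sub[OF that(2)] that(3)]
            subgradient_eq_gradient[OF grad[OF that(2)]] by simp
      qed (use U in auto)
    qed (use U in auto)
  qed
qed

section \<open>Uncountable level sets by returning mass and Fubini\<close>

text \<open>A neighbourhood of \<open>F\<close> with little excess volume has no room outside
  \<open>F\<close> for the image of almost all of \<open>F\<close> under \<open>T t\<close>, as this
  map hardly reduces volume. Part of \<open>F\<close> therefore returns to \<open>F\<close> for
  every small \<open>t\<close>.\<close>

lemma ex_uncountable_gradient_level_set:
  fixes \<psi> :: "'b::euclidean_space \<Rightarrow> ereal" and v :: "'b \<Rightarrow> 'b"
  assumes \<psi>: "proper_lsc_convex \<psi>"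
    and F: "compact F" and pos: "emeasure lborel F \<noteq> 0" and v: "continuous_on F v"
    and grad: "\<And>y. y \<in> F \<Longrightarrow> is_gradient_at \<psi> (v y) y"
    and K: "compact K" "convex K" and disj: "F \<inter> K = {}"
    and meet: "\<And>y. y \<in> F \<Longrightarrow> \<exists>z\<in>K. is_subgradient_at \<psi> (v y) z"
  shows "\<exists>y\<in>F. uncountable {x\<in>F. v x = v y}"
proof -
  have FB[measurable]: "F \<in> sets borel"
    using F by (simp add: compact_imp_closed)
  have "F \<noteq> {}"
    using pos by auto
  \<comment> \<open>Extension by 0 turns \<open>v\<close>, which is controlled on \<open>F\<close>
    only, into a Borel function on the whole space.\<close>
  define v' where "v' y = (if y \<in> F then v y else 0)" for y
  have v'B: "v' \<in> borel_measurable borel"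
    unfolding v'_def by (rule borel_measurable_continuous_on_if) (auto intro: v)
  have v'F: "v' ` F \<subseteq> v ` F"
    by (auto simp: v'_def)
  have grad': "\<forall>y\<in>F. is_gradient_at \<psi> (v' y) y"
    and meet': "\<forall>y\<in>F. \<exists>z\<in>K. is_subgradient_at \<psi> (v' y) z"
    using grad meet by (simp_all add: v'_def)
  obtain w where w[measurable]: "w \<in> borel_measurable borel"
    and wK': "\<forall>y\<in>F. w y \<in> K \<and> is_subgradient_at \<psi> (v' y) (w y)"
    and contr: "\<forall>t U. 0 \<le> t \<and> t < 1 \<and> open U \<longrightarrow>
       ennreal ((1 - t) ^ DIM('b)) * emeasure lborel {y\<in>F. (1 - t) *\<^sub>R y + t *\<^sub>R w y \<in> U}
         \<le> emeasure lborel U"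
    using subgradient_preimage_contraction[OF \<psi> FB \<open>F \<noteq> {}\<close> v'B
          compact_continuous_image[OF v F] v'F grad' K meet']
    by (elim bexE conjE) (rule that)
  have wK: "w y \<in> K" "is_subgradient_at \<psi> (v y) (w y)" if "y \<in> F" for y
    using wK' that by (simp_all add: v'_def)
  define T where "T t y = (1 - t) *\<^sub>R y + t *\<^sub>R w y" for t y

  have fin: "emeasure lborel F < \<infinity>"
    using F by (rule emeasure_compact_finite)
  define \<mu> where "\<mu> = enn2real (emeasure lborel F)"
  have \<mu>: "emeasure lborel F = ennreal \<mu>" "0 < \<mu>"
    using fin pos by (auto simp: \<mu>_def enn2real_positive_iff less_top zero_less_iff_neq_zero)
  \<comment> \<open>For \<open>t \<le> 1/2\<close> this is a lower bound for the volume of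
    \<open>F\<close> after contraction by the factor \<open>1 - t\<close>.\<close>
  define e where "e = (1 / 2) ^ DIM('b) * \<mu>"
  have e: "0 < e"
    using \<mu>(2) by (simp add: e_def)
  obtain U where U: "open U" "F \<subseteq> U" "emeasure lborel (U - F) < ennreal e"
    using outer_regular_lborel[OF FB e] by metis
  obtain \<epsilon> where \<epsilon>: "0 < \<epsilon>" "(\<Union>x\<in>F. ball x \<epsilon>) \<subseteq> U"
    using compact_subset_open_imp_ball_epsilon_subset[OF F U(1,2)] by metis
  obtain C where C: "0 < C" "\<And>x. x \<in> F \<union> K \<Longrightarrow> norm x \<le> C"
    using compact_imp_bounded[OF compact_Un[OF F K(1)]] unfolding bounded_pos by metis
  \<comment> \<open>The bound \<open>1/2\<close> serves the choice of \<open>e\<close>. The other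
    bound keeps the displacement, at most \<open>2 * C * t\<close>, below \<open>\<epsilon>\<close>,
    so that \<open>T t\<close> maps \<open>F\<close> into \<open>U\<close>.\<close>
  define \<delta> where "\<delta> = min (1 / 2) (\<epsilon> / (4 * C))"
  have \<delta>: "0 < \<delta>"
    using \<epsilon> C by (simp add: \<delta>_def)

  have return: "emeasure lborel {y\<in>F. T t y \<in> F} \<noteq> 0" if t: "t \<in> {0..\<delta>}" for t
  proof
    assume zero: "emeasure lborel {y\<in>F. T t y \<in> F} = 0"
    have t': "0 \<le> t" "t \<le> 1 / 2" "t \<le> \<epsilon> / (4 * C)"
      using t by (auto simp: \<delta>_def)
    have TU: "T t y \<in> U" if y: "y \<in> F" for y
    proof -
      have "dist y (T t y) = norm (t *\<^sub>R (w y - y))"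
        by (simp add: dist_norm T_def algebra_simps norm_minus_commute)
      also have "\<dots> \<le> t * (2 * C)"
        using C(2)[of y] C(2)[of "w y"] y wK(1)[OF y] norm_triangle_ineq4[of "w y" y] t'(1)
        by (auto intro!: mult_left_mono)
      also have "\<dots> \<le> \<epsilon> / (4 * C) * (2 * C)"
        using t'(3) C(1) by (intro mult_right_mono) auto
      also have "\<dots> < \<epsilon>"
        using C(1) \<epsilon>(1) by simp
      finally have "T t y \<in> (\<Union>x\<in>F. ball x \<epsilon>)"
        using y by auto
      then show ?thesis
        by (rule subsetD[OF \<epsilon>(2)])
    qed
    have TB[measurable]: "T t \<in> borel_measurable borel"
      unfolding T_def by measurable
    have UB[measurable]: "U \<in> sets borel"
      using U by simp
    have "F = {y\<in>F. T t y \<in> U - F} \<union> {y\<in>F. T t y \<in> F}"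
      using TU by auto
    then have "emeasure lborel F \<le> emeasure lborel {y\<in>F. T t y \<in> U - F} + emeasure lborel {y\<in>F. T t y \<in> F}"
      using emeasure_subadditive[of "{y\<in>F. T t y \<in> U - F}" lborel "{y\<in>F. T t y \<in> F}"] by simp
    then have le: "emeasure lborel F \<le> emeasure lborel {y\<in>F. T t y \<in> U - F}"
      using zero by simp
    have "ennreal e \<le> ennreal ((1 - t) ^ DIM('b)) * emeasure lborel F"
      unfolding \<mu> e_def using t' \<mu>(2)
      by (subst ennreal_mult[symmetric]) (auto intro!: ennreal_leI mult_right_mono power_mono)
    also have "\<dots> \<le> ennreal ((1 - t) ^ DIM('b)) * emeasure lborel {y\<in>F. T t y \<in> U - F}"
      by (intro mult_left_mono le) simp
    \<comment> \<open>The set \<open>U - F\<close> is open because \<open>F\<close> is closed, so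
      the contraction estimate applies to it.\<close>
    also have "\<dots> \<le> emeasure lborel (U - F)"
      using contr[rule_format, of t "U - F"] t' U(1) F by (simp add: T_def compact_imp_closed open_Diff)
    finally show False
      using U(3) by simp
  qed

  have "\<exists>y\<in>F. uncountable {t\<in>{0..\<delta>}. T t y \<in> F}"
  proof (rule ccontr)
    assume "\<not> ?thesis"
    then have cnt: "countable {t\<in>{0..\<delta>}. T t y \<in> F}" if "y \<in> F" for y
      using that by blast
    \<comment> \<open>Fubini on the pairs \<open>(t, y)\<close> that return to \<open>F\<close>:
      sections at fixed \<open>y\<close> are countable, hence null, whereas those at fixed
      \<open>t\<close> in the interval have positive measure.\<close>
    define A where "A = {p \<in> space (lborel \<Otimes>\<^sub>M lborel). fst p \<in> {0..\<delta>} \<and> snd p \<in> F \<and> T (fst p) (snd p) \<in> F}"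
    have A: "A \<in> sets (lborel \<Otimes>\<^sub>M lborel)"
      unfolding A_def T_def by measurable
    have "emeasure lborel ((\<lambda>t. (t, y)) -` A) = 0" for y
    proof -
      have "countable ((\<lambda>t. (t, y)) -` A)"
      proof (cases "y \<in> F")
        case True
        then have "(\<lambda>t. (t, y)) -` A = {t\<in>{0..\<delta>}. T t y \<in> F}"
          by (auto simp: A_def space_pair_measure)
        then show ?thesis using cnt[OF True] by simp
      next
        case False
        then have "(\<lambda>t. (t, y)) -` A = {}"
          by (auto simp: A_def)
        then show ?thesis by simp
      qed
      then show ?thesis
        by (rule emeasure_lborel_countable)
    qed
    then have "emeasure (lborel \<Otimes>\<^sub>M lborel) A = 0"
      using lborel_pair.emeasure_pair_measure_alt2[OF A] by simp
    moreover have "emeasure (lborel \<Otimes>\<^sub>M lborel) A = (\<integral>\<^sup>+ t. emeasure lborel (Pair t -` A) \<partial>lborel)"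
      by (rule lborel.emeasure_pair_measure_alt[OF A])
    ultimately have "(\<integral>\<^sup>+ t. emeasure lborel (Pair t -` A) \<partial>lborel) = 0"
      by simp
    then have "AE t in lborel. emeasure lborel (Pair t -` A) = 0"
      using lborel.measurable_emeasure_Pair[OF A] by (subst (asm) nn_integral_0_iff_AE) auto
    moreover have "emeasure lborel (Pair t -` A) \<noteq> 0" if "t \<in> {0..\<delta>}" for t
    proof -
      have "Pair t -` A = {y\<in>F. T t y \<in> F}"
        using that by (auto simp: A_def space_pair_measure)
      then show ?thesis using return[OF that] by simp
    qed
    ultimately have "AE t in lborel. t \<notin> {0..\<delta>}"
      by (auto elim!: eventually_mono)
    then have "emeasure lborel {0..\<delta>} = 0"
      by (subst (asm) AE_iff_measurable[of "{0..\<delta>}"]) auto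
    then show False
      using \<delta> by simp
  qed
  then obtain y where y: "y \<in> F" and unc: "uncountable {t\<in>{0..\<delta>}. T t y \<in> F}"
    by blast
  \<comment> \<open>The segment from \<open>y\<close> to \<open>w y\<close> is nondegenerate, since
    its ends lie in the disjoint sets \<open>F\<close> and \<open>K\<close>.\<close>
  have "inj_on (\<lambda>t. T t y) {t\<in>{0..\<delta>}. T t y \<in> F}"
  proof (rule inj_onI)
    fix t t' assume "T t y = T t' y"
    then have "(t - t') *\<^sub>R (w y - y) = 0"
      by (simp add: T_def algebra_simps)
    moreover have "w y \<noteq> y"
      using wK(1)[OF y] y disj by auto
    ultimately show "t = t'" by simp
  qed
  then have "uncountable ((\<lambda>t. T t y) ` {t\<in>{0..\<delta>}. T t y \<in> F})"
    using unc countable_image_inj_on by blast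
  \<comment> \<open>Along the segment \<open>v y\<close> remains a subgradient, and at points of
    \<open>F\<close> the gradient is the only subgradient.\<close>
  moreover have "(\<lambda>t. T t y) ` {t\<in>{0..\<delta>}. T t y \<in> F} \<subseteq> {x\<in>F. v x = v y}"
  proof safe
    fix t assume t: "t \<in> {0..\<delta>}" "T t y \<in> F"
    have "is_subgradient_at \<psi> (v y) (T t y)"
      unfolding T_def
      using subgradient_segment[OF \<psi> is_gradient_at_imp_subgradient[OF \<psi> grad[OF y]] wK(2)[OF y]] t(1)
      by (simp add: \<delta>_def)
    then show "v (T t y) = v y"
      using subgradient_eq_gradient[OF grad[OF t(2)]] by simp
  qed
  ultimately show ?thesis
    using y countable_subset by blast
qed

section \<open>Compact sets of positive measure\<close>

text \<open>Inner regularity gives a closed subset of positive measure, and intersecting it with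
  balls of integer radius exhausts it by compact sets.\<close>

lemma compact_subset_nonnull:
  fixes S :: "'a::euclidean_space set"
  assumes S: "S \<in> sets lebesgue" and pos: "emeasure lebesgue S \<noteq> 0"
  obtains C where "compact C" "C \<subseteq> S" "emeasure lebesgue C \<noteq> 0"
proof -
  \<comment> \<open>A positive real bound is needed even when \<open>S\<close> has infinite
    measure.\<close>
  obtain e :: real where e: "0 < e" "ennreal e \<le> emeasure lebesgue S"
  proof (cases "emeasure lebesgue S = \<infinity>")
    case True
    then show ?thesis using that[of 1] by simp
  next
    case False
    then have "0 < enn2real (emeasure lebesgue S)"
      using pos by (simp add: enn2real_positive_iff less_top zero_less_iff_neq_zero)
    then show ?thesis using that[of "enn2real (emeasure lebesgue S)"] False by (simp add: less_top)
  qed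
  obtain T where T: "closed T" "T \<subseteq> S" "emeasure lebesgue (S - T) < ennreal e"
    using sets_lebesgue_inner_closed[OF S e(1)] by metis
  have TL: "T \<in> sets lebesgue"
    using T(1) by (simp add: borel_closed)
  have "\<exists>n. emeasure lebesgue (T \<inter> cball 0 (real n)) \<noteq> 0"
  proof (rule ccontr)
    assume "\<not> ?thesis"
    then have "(\<Union>n. T \<inter> cball 0 (real n)) \<in> null_sets lebesgue"
      using T(1) by (intro null_sets_UN null_setsI) (auto simp: borel_closed)
    moreover have "(\<Union>n. T \<inter> cball 0 (real n)) = T"
      by (auto simp: real_arch_simple)
    ultimately have "emeasure lebesgue T = 0"
      by (simp add: null_setsD1)
    moreover have "emeasure lebesgue S \<le> emeasure lebesgue (S - T) + emeasure lebesgue T"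
      using emeasure_subadditive[of "S - T" lebesgue T] S TL T(2) by (simp add: Un_absorb2)
    ultimately show False
      using T(3) e(2) by simp
  qed
  then obtain n where "emeasure lebesgue (T \<inter> cball 0 (real n)) \<noteq> 0" by blast
  then show thesis
    using T by (intro that[of "T \<inter> cball 0 (real n)"]) (auto intro: closed_Int_compact)
qed

text \<open>Lusin's theorem: each preimage of a basic open set is enlarged to an open set
  \<open>G i\<close>. Off the union \<open>N\<close> of the excesses the two agree, so these
  preimages are relatively open.\<close>

lemma lusin_compact:
  fixes f :: "'a::euclidean_space \<Rightarrow> 'b::second_countable_topology"
  assumes f[measurable]: "f \<in> borel_measurable lebesgue"
    and S: "S \<in> sets lebesgue" and pos: "emeasure lebesgue S \<noteq> 0"
  obtains C where "compact C" "C \<subseteq> S" "emeasure lebesgue C \<noteq> 0" "continuous_on C f"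
proof -
  obtain S' where S': "compact S'" "S' \<subseteq> S" "emeasure lebesgue S' \<noteq> 0"
    using compact_subset_nonnull[OF S pos] by metis
  have S'L: "S' \<in> sets lebesgue"
    using S'(1) by (simp add: borel_closed compact_imp_closed)
  define m where "m = enn2real (emeasure lebesgue S')"
  have m: "emeasure lebesgue S' = ennreal m" "0 < m"
    using S' emeasure_compact_finite[OF S'(1)]
    by (auto simp: m_def enn2real_positive_iff less_top zero_less_iff_neq_zero borel_closed compact_imp_closed)
  obtain \<B> :: "'b set set" where \<B>: "countable \<B>" "topological_basis \<B>"
    using ex_countable_basis by blast
  have "\<B> \<noteq> {}"
    using topological_basisE[OF \<B>(2) open_UNIV UNIV_I] by blast
  define B where "B = from_nat_into \<B>"
  have B: "range B = \<B>"
    unfolding B_def using \<B>(1) \<open>\<B> \<noteq> {}\<close> by (rule range_from_nat_into[rotated])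
  have Bo: "open (B i)" for i
    using \<B>(2) B topological_basis_open by blast
  have pre: "f -` B i \<in> sets lebesgue" for i
    using measurable_sets[OF f, of "B i"] Bo by simp
  \<comment> \<open>The geometric bounds add up to \<open>m / 2\<close>, so removing all excesses
    leaves positive measure in \<open>S'\<close>.\<close>
  have "\<exists>G. open G \<and> f -` B i \<subseteq> G \<and> emeasure lebesgue (G - f -` B i) < ennreal (m / 4 * (1 / 2) ^ i)" for i
    using sets_lebesgue_outer_open[OF pre, of "m / 4 * (1 / 2) ^ i"] m(2) by (metis divide_pos_pos mult_pos_pos zero_less_numeral zero_less_one zero_less_power)
  then obtain G where G: "\<And>i. open (G i)" "\<And>i. f -` B i \<subseteq> G i"
      "\<And>i. emeasure lebesgue (G i - f -` B i) < ennreal (m / 4 * (1 / 2) ^ i)"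
    by metis
  have GL: "G i - f -` B i \<in> sets lebesgue" for i
    using G(1) pre by (intro sets.Diff) auto
  define N where "N = (\<Union>i. G i - f -` B i)"
  have NL: "N \<in> sets lebesgue"
    unfolding N_def using GL by blast
  have "emeasure lebesgue N \<le> (\<Sum>i. emeasure lebesgue (G i - f -` B i))"
    unfolding N_def using GL by (intro emeasure_subadditive_countably) auto
  also have "\<dots> \<le> (\<Sum>i. ennreal (m / 4 * (1 / 2) ^ i))"
    using G(3) by (intro suminf_le) (auto intro: less_imp_le)
  also have "\<dots> = ennreal (m / 2)"
  proof (rule suminf_ennreal_eq)
    show "(\<lambda>i. m / 4 * (1 / 2) ^ i) sums (m / 2)"
      using sums_mult[OF geometric_sums[of "1/2::real"], of "m / 4"] by simp
  qed (use m in simp)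
  also have "\<dots> < ennreal m"
    using m(2) by (simp add: ennreal_lessI)
  finally have N: "emeasure lebesgue N < emeasure lebesgue S'"
    by (simp add: m(1))
  have "emeasure lebesgue (S' - N) \<noteq> 0"
  proof
    assume "emeasure lebesgue (S' - N) = 0"
    moreover have "emeasure lebesgue S' \<le> emeasure lebesgue (S' - N) + emeasure lebesgue N"
    proof -
      have "emeasure lebesgue S' \<le> emeasure lebesgue ((S' - N) \<union> N)"
        using S'L NL by (intro emeasure_mono) auto
      also have "\<dots> \<le> emeasure lebesgue (S' - N) + emeasure lebesgue N"
        using S'L NL by (intro emeasure_subadditive) auto
      finally show ?thesis .
    qed
    ultimately show False using N by simp
  qed
  then obtain C where C: "compact C" "C \<subseteq> S' - N" "emeasure lebesgue C \<noteq> 0"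
    using compact_subset_nonnull[of "S' - N"] S'L NL by (metis sets.Diff)
  have "continuous_on C f"
    unfolding continuous_on_topological
  proof (intro ballI allI impI)
    fix x W assume x: "x \<in> C" and W: "open W" "f x \<in> W"
    then obtain i where i: "f x \<in> B i" "B i \<subseteq> W"
      using topological_basisE[OF \<B>(2) W] B by (metis rangeE)
    have "f y \<in> W" if "y \<in> C" "y \<in> G i" for y
    proof -
      have "y \<notin> N" using C(2) that by auto
      then show ?thesis using that i(2) by (auto simp: N_def)
    qed
    moreover have "x \<in> G i"
      using G(2) i(1) by auto
    ultimately show "\<exists>A. open A \<and> x \<in> A \<and> (\<forall>y\<in>C. y \<in> A \<longrightarrow> f y \<in> W)"
      using G(1) by blast
  qed
  then show thesis
    using that C S'(2) by blast
qed

text \<open>The image of \<open>P\<close> is not known to be measurable. In the coordinate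
  \<open>\<tau>\<close> the map \<open>s\<close> becomes a Lebesgue measurable function on the line;
  Lusin's theorem makes it continuous on a compact set \<open>D\<close>, whose image
  \<open>F\<close> is compact. Since \<open>s\<close> preserves measure, \<open>F\<close> has at
  least the measure of \<open>D\<close>.\<close>

lemma measure_interval_compact_in_image:
  fixes s :: "'a \<Rightarrow> 'b::euclidean_space"
  assumes mi: "measure_interval M" and s: "measure_preserving_to M Y s"
    and C: "compact C" "C \<subseteq> Y" and P: "P \<in> sets M" "s ` P \<subseteq> C" and pos: "emeasure M P \<noteq> 0"
  shows "\<exists>F. compact F \<and> F \<subseteq> s ` P \<and> emeasure lebesgue F \<noteq> 0"
proof -
  obtain X I and \<tau> :: "'a \<Rightarrow> real" where
    X: "X \<in> sets M" "space M - X \<in> null_sets M" and bij: "bij_betw \<tau> X I"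
    and pull: "\<forall>A\<in>sets lebesgue. A \<subseteq> I \<longrightarrow>
          \<tau> -` A \<inter> X \<in> sets M \<and> emeasure M (\<tau> -` A \<inter> X) = emeasure lebesgue A"
    and push: "\<forall>A\<in>sets M. A \<subseteq> X \<longrightarrow>
          \<tau> ` A \<in> sets lebesgue \<and> emeasure lebesgue (\<tau> ` A) = emeasure M A"
    using mi unfolding measure_interval_def by (elim conjE exE) (rule that)
  have inj: "inj_on \<tau> X" and im: "\<tau> ` X = I"
    using bij by (auto simp: bij_betw_def)
  have sB: "s -` A \<inter> space M \<in> sets M" "emeasure M (s -` A \<inter> space M) = emeasure lebesgue A"
    if "A \<in> sets borel" "A \<subseteq> Y" for A
    using s that by (auto simp: measure_preserving_to_def)
  define P' where "P' = P \<inter> X"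
  have P': "P' \<in> sets M" "P' \<subseteq> X"
    using P X by (auto simp: P'_def)
  have "P - P' \<in> null_sets M"
    using P P' sets.sets_into_space[OF P(1)] by (intro null_sets_subset[OF X(2)]) (auto simp: P'_def)
  then have "emeasure M P' = emeasure M P"
    using emeasure_Diff_null_set[of "P - P'" M P] P by (simp add: P'_def double_diff Diff_Diff_Int Int_absorb1)
  then have pos': "emeasure M P' \<noteq> 0"
    using pos by simp
  define Q where "Q = \<tau> ` P'"
  have Q: "Q \<in> sets lebesgue" "emeasure lebesgue Q \<noteq> 0"
    using push P' pos' by (auto simp: Q_def)
  define g where "g r = (if r \<in> Q then s (the_inv_into X \<tau> r) else 0)" for r
  have g: "g (\<tau> x) = s x" if "x \<in> P'" for x
    using that P'(2) the_inv_into_f_f[OF inj] by (auto simp: g_def Q_def)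
  have "g \<in> borel_measurable lebesgue"
  proof (rule borel_measurableI)
    fix A :: "'b set" assume "open A"
    \<comment> \<open>Measure preservation speaks only of Borel subsets of \<open>Y\<close>.
      Intersecting with \<open>C\<close> provides one and loses nothing, as \<open>s\<close> maps
      \<open>P\<close> into \<open>C\<close>.\<close>
    then have "A \<inter> C \<in> sets borel"
      using C by (simp add: compact_imp_closed)
    then have "s -` (A \<inter> C) \<inter> space M \<inter> P' \<in> sets M"
      using sB(1)[of "A \<inter> C"] C P' by auto
    then have 1: "\<tau> ` (s -` (A \<inter> C) \<inter> space M \<inter> P') \<in> sets lebesgue"
      using push P'(2) by blast
    have "s x \<in> C" "x \<in> space M" if "x \<in> P'" for x
      using that P(2) sets.sets_into_space[OF P(1)] by (auto simp: P'_def)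
    then have 2: "\<tau> ` (s -` (A \<inter> C) \<inter> space M \<inter> P') = g -` A \<inter> Q"
      using g by (auto simp: Q_def)
    have 3: "g -` A - Q = (if 0 \<in> A then - Q else {})"
      by (auto simp: g_def split: if_splits)
    have "g -` A = (g -` A \<inter> Q) \<union> (g -` A - Q)" by auto
    also have "\<dots> \<in> sets lebesgue"
      using 1 Q(1) unfolding 2 3 by (auto intro: Compl_in_sets_lebesgue[THEN iffD2])
    finally show "g -` A \<inter> space lebesgue \<in> sets lebesgue" by simp
  qed
  then obtain D where D: "compact D" "D \<subseteq> Q" "emeasure lebesgue D \<noteq> 0" "continuous_on D g"
    using lusin_compact[OF _ Q] by metis
  define F where "F = g ` D"
  have F: "compact F"
    unfolding F_def by (rule compact_continuous_image[OF D(4,1)])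
  have Fs: "F \<subseteq> s ` P'"
    using D(2) g by (force simp: F_def Q_def)
  then have FY: "F \<subseteq> Y"
    using P C by (auto simp: P'_def)
  have FB: "F \<in> sets borel"
    using F by (simp add: compact_imp_closed)
  have "D \<in> sets lebesgue" "D \<subseteq> I"
    using D P' im by (auto simp: Q_def borel_closed compact_imp_closed)
  then have "emeasure lebesgue D = emeasure M (\<tau> -` D \<inter> X)"
    using pull by simp
  also have "\<dots> \<le> emeasure M (s -` F \<inter> space M)"
  proof (rule emeasure_mono)
    show "\<tau> -` D \<inter> X \<subseteq> s -` F \<inter> space M"
    proof
      fix x assume x: "x \<in> \<tau> -` D \<inter> X"
      then obtain p where p: "p \<in> P'" "\<tau> x = \<tau> p"
        using D(2) by (auto simp: Q_def)
      then have "x = p"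
        using inj x P'(2) by (auto dest: inj_onD)
      then have "s x = g (\<tau> x)" using g p by simp
      then show "x \<in> s -` F \<inter> space M"
        using x sets.sets_into_space[OF X(1)] by (auto simp: F_def)
    qed
  qed (rule sB(1)[OF FB FY])
  also have "\<dots> = emeasure lebesgue F"
    by (rule sB(2)[OF FB FY])
  finally have "emeasure lebesgue F \<noteq> 0"
    using D(3) by auto
  then show ?thesis
    using F Fs by (auto simp: P'_def)
qed

section \<open>Almost injectivity of the gradient\<close>

text \<open>Compactness of \<open>K\<close> supplies a limit of the base points along a subsequence,
  and subgradients pass to the limit.\<close>

lemma closed_subgradient_image:
  assumes \<psi>: "proper_lsc_convex \<psi>" and K: "compact K"
  shows "closed {b. \<exists>z\<in>K. is_subgradient_at \<psi> b z}"
  unfolding closed_sequential_limits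
proof (intro allI impI, elim conjE)
  fix b l assume b: "\<forall>n. b n \<in> {b. \<exists>z\<in>K. is_subgradient_at \<psi> b z}" and l: "b \<longlonglongrightarrow> l"
  have "\<forall>n. \<exists>z. z \<in> K \<and> is_subgradient_at \<psi> (b n) z"
    using b by blast
  then obtain z where z: "\<forall>n. z n \<in> K \<and> is_subgradient_at \<psi> (b n) (z n)"
    by (rule choice[THEN exE])
  obtain a and q :: "nat \<Rightarrow> nat" where a: "a \<in> K" and q: "strict_mono q" "(z \<circ> q) \<longlonglongrightarrow> a"
    using K[unfolded compact_def, rule_format, of z] z by blast
  have "is_subgradient_at \<psi> l a"
  proof (rule approximate_subgradient_limit[OF \<psi>, of "\<lambda>n. z (q n)" _ "\<lambda>n. b (q n)" _ "\<lambda>_. 0"])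
    show "(\<lambda>n. z (q n)) \<longlonglongrightarrow> a" "(\<lambda>n. b (q n)) \<longlonglongrightarrow> l"
      using q(2) LIMSEQ_subseq_LIMSEQ[OF l q(1)] by (simp_all add: o_def)
    show "\<bar>\<psi> (z (q n))\<bar> \<noteq> \<infinity>" for n
      using z by (simp add: is_subgradient_at_def)
    show "real_of_ereal (\<psi> (z (q n))) + b (q n) \<bullet> (x - z (q n)) \<le> real_of_ereal (\<psi> x) + 0"
      if "\<bar>\<psi> x\<bar> \<noteq> \<infinity>" for n x
      using is_subgradient_atD[of \<psi> "b (q n)" "z (q n)" x] z that by simp
  qed simp
  then show "l \<in> {b. \<exists>z\<in>K. is_subgradient_at \<psi> b z}"
    using a by blast
qed

text \<open>Balls around a countable dense set suffice. Their purpose is to split failure of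
  injectivity into countably many cases, each with one point in a fixed compact convex set and the
  other outside it.\<close>

lemma ex_countable_separating_cballs:
  "\<exists>\<K> :: 'b::euclidean_space set set. countable \<K> \<and> (\<forall>K\<in>\<K>. compact K \<and> convex K) \<and>
    (\<forall>y z. y \<noteq> z \<longrightarrow> (\<exists>K\<in>\<K>. z \<in> K \<and> y \<notin> K))"
proof -
  obtain D :: "'b set" where D: "countable D" "\<And>X. open X \<Longrightarrow> X \<noteq> {} \<Longrightarrow> \<exists>d\<in>D. d \<in> X"
    by (rule countable_dense_setE) blast
  define \<K> where "\<K> = (\<lambda>(q, n). cball q (1 / real (Suc n))) ` (D \<times> (UNIV :: nat set))"
  have "\<exists>K\<in>\<K>. z \<in> K \<and> y \<notin> K" if "y \<noteq> z" for y z
  proof -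
    have "0 < dist y z / 2" using that by simp
    \<comment> \<open>With the diameter below \<open>dist y z\<close>, a ball that contains
      \<open>z\<close> cannot contain \<open>y\<close>.\<close>
    then obtain n where n: "1 / real (Suc n) < dist y z / 2"
      using nat_approx_posE by metis
    have "\<exists>q\<in>D. q \<in> ball z (1 / real (Suc n))"
      by (intro D(2)) auto
    then obtain q where q: "q \<in> D" "dist z q < 1 / real (Suc n)"
      by auto
    have "1 / real (Suc n) < dist q y"
      using n q(2) dist_triangle[of y z q] by (simp add: dist_commute)
    then have "z \<in> cball q (1 / real (Suc n)) \<and> y \<notin> cball q (1 / real (Suc n))"
      using q(2) by (simp add: dist_commute)
    then show ?thesis
      using q(1) unfolding \<K>_def by (intro bexI[of _ "cball q (1 / real (Suc n))"]) auto
  qed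
  moreover have "countable \<K>"
    unfolding \<K>_def using D(1) by simp
  moreover have "\<forall>K\<in>\<K>. compact K \<and> convex K"
    by (auto simp: \<K>_def)
  ultimately show ?thesis by blast
qed

text \<open>\<open>E K\<close> collects the points outside \<open>K\<close> whose gradient is also a
  subgradient somewhere in \<open>K\<close>. Were it not null, Lusin's theorem and
  \<open>cnt\<close> would give a compact set with only countable level sets, contrary to the
  existence of an uncountable one. Removing all \<open>E K\<close> leaves an injective map.\<close>

lemma gradient_almost_injective:
  fixes v :: "'b::euclidean_space \<Rightarrow> 'b"
  assumes \<psi>: "proper_lsc_convex \<psi>" and W: "W \<in> sets lebesgue"
    and v: "v \<in> borel_measurable (lebesgue_on W)"
    and grad: "\<And>y. y \<in> W \<Longrightarrow> is_gradient_at \<psi> (v y) y"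
    and cnt: "\<And>C. compact C \<Longrightarrow> C \<subseteq> W \<Longrightarrow> emeasure lebesgue C \<noteq> 0 \<Longrightarrow>
      \<exists>F\<subseteq>C. compact F \<and> emeasure lebesgue F \<noteq> 0 \<and> (\<forall>a. countable {x\<in>F. v x = a})"
  shows "\<exists>U\<subseteq>W. W - U \<in> null_sets lebesgue \<and> inj_on v U"
proof -
  define v' where "v' y = (if y \<in> W then v y else 0)" for y
  have v': "v' \<in> borel_measurable lebesgue"
    unfolding v'_def using v W by (simp add: borel_measurable_if)
  obtain \<K> :: "'b set set" where \<K>: "countable \<K>" "\<And>K. K \<in> \<K> \<Longrightarrow> compact K" "\<And>K. K \<in> \<K> \<Longrightarrow> convex K"
    and sep: "\<And>y z. y \<noteq> z \<Longrightarrow> \<exists>K\<in>\<K>. z \<in> K \<and> y \<notin> K"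
    using ex_countable_separating_cballs by metis
  define H where "H K = {b. \<exists>z\<in>K. is_subgradient_at \<psi> b z}" for K
  define E where "E K = {y\<in>W. y \<notin> K \<and> v y \<in> H K}" for K
  have null: "E K \<in> null_sets lebesgue" if K: "K \<in> \<K>" for K
  proof -
    have "closed (H K)"
      unfolding H_def by (rule closed_subgradient_image[OF \<psi> \<K>(2)[OF K]])
    then have "v' -` H K \<inter> space lebesgue \<in> sets lebesgue"
      by (intro measurable_sets[OF v']) simp
    moreover have "E K = (W - K) \<inter> (v' -` H K)"
      by (auto simp: E_def v'_def)
    ultimately have EL: "E K \<in> sets lebesgue"
      using W \<K>(2)[OF K] by (simp add: borel_closed compact_imp_closed sets.Diff sets.Int)
    have "emeasure lebesgue (E K) = 0"
    proof (rule ccontr)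
      assume "emeasure lebesgue (E K) \<noteq> 0"
      then obtain C where C: "compact C" "C \<subseteq> E K" "emeasure lebesgue C \<noteq> 0" "continuous_on C v'"
        using lusin_compact[OF v' EL] by metis
      have "C \<subseteq> W"
        using C(2) by (auto simp: E_def)
      then obtain F where F: "F \<subseteq> C" "compact F" "emeasure lebesgue F \<noteq> 0"
          "\<forall>a. countable {x\<in>F. v x = a}"
        using cnt[OF C(1) _ C(3)] by blast
      have FE: "F \<subseteq> E K" and FW: "F \<subseteq> W"
        using F(1) C(2) \<open>C \<subseteq> W\<close> by auto
      have "\<exists>y\<in>F. uncountable {x\<in>F. v x = v y}"
      proof (rule ex_uncountable_gradient_level_set[OF \<psi> F(2)])
        show "emeasure lborel F \<noteq> 0"
          using F(2,3) by (simp add: compact_imp_closed)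
        have "continuous_on F v'"
          using C(4) F(1) by (rule continuous_on_subset)
        then show "continuous_on F v"
          by (rule continuous_on_eq) (use FW in \<open>auto simp: v'_def\<close>)
        show "is_gradient_at \<psi> (v y) y" if "y \<in> F" for y
          using grad FW that by blast
        show "\<exists>z\<in>K. is_subgradient_at \<psi> (v y) z" if "y \<in> F" for y
          using FE that by (auto simp: E_def H_def)
        show "F \<inter> K = {}"
          using FE by (auto simp: E_def)
      qed (use \<K> K in auto)
      then show False using F(4) by blast
    qed
    then show ?thesis using EL by auto
  qed
  define U where "U = W - (\<Union>K\<in>\<K>. E K)"
  have "(\<Union>K\<in>\<K>. E K) \<in> null_sets lebesgue"
    using \<K>(1) null by (intro null_sets_UN') auto
  moreover have "W - U = (\<Union>K\<in>\<K>. E K)"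
    by (auto simp: U_def E_def)
  moreover have "inj_on v U"
  proof (rule inj_onI, rule ccontr)
    fix y y' assume y: "y \<in> U" "y' \<in> U" "v y = v y'" "y \<noteq> y'"
    then obtain K where K: "K \<in> \<K>" "y' \<in> K" "y \<notin> K"
      using sep by blast
    have "is_subgradient_at \<psi> (v y) y'"
      using is_gradient_at_imp_subgradient[OF \<psi> grad[of y']] y by (simp add: U_def)
    then have "y \<in> E K"
      using K y(1) by (auto simp: E_def H_def U_def)
    then show False
      using y(1) K(1) by (auto simp: U_def)
  qed
  ultimately show ?thesis
    by (intro exI[of _ U]) (auto simp: U_def)
qed

section \<open>Level sets of positive measure and polar factorisations\<close>

text \<open>Only countably many level sets have positive measure, because the finite image measure
  has countably many atoms. Hence the complement is the preimage of a Borel set. A level set with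
  value in \<open>B\<close> lies wholly in the preimage of \<open>B\<close>, so restriction does not
  change its measure.\<close>

lemma pos_level_complement_restrict:
  fixes f :: "'a \<Rightarrow> 'b::euclidean_space"
  assumes N: "finite_measure N" and f: "f \<in> borel_measurable N" and B: "B \<in> sets borel"
  defines "R \<equiv> restrict_space N (f -` B \<inter> space N)"
  shows "pos_level_complement R f
      = {x\<in>space N. f x \<in> B \<and> emeasure N (f -` {f x} \<inter> space N) = 0}" (is "?W = ?W'")
    and "pos_level_complement R f \<in> sets N"
    and "space (restrict_space R (pos_level_complement R f)) = pos_level_complement R f"
    and "A \<in> null_sets (restrict_space R (pos_level_complement R f)) \<longleftrightarrow>
      A \<subseteq> pos_level_complement R f \<and> A \<in> null_sets N"
proof -
  have \<Omega>: "f -` B \<inter> space N \<in> sets N"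
    using f B by (rule measurable_sets)
  have spR: "space R = f -` B \<inter> space N"
    by (auto simp: R_def space_restrict_space)
  have em: "emeasure R (f -` {a} \<inter> space R) = emeasure N (f -` {a} \<inter> space N)" if "a \<in> B" for a
  proof -
    have "f -` {a} \<inter> (f -` B \<inter> space N) = f -` {a} \<inter> space N"
      using that by auto
    then show ?thesis
      unfolding spR R_def using \<Omega> that by (subst emeasure_restrict_space) auto
  qed
  show eq: "?W = ?W'"
  proof (intro set_eqI iffI)
    fix x assume x: "x \<in> ?W"
    then have xR: "x \<in> space R" by (simp add: pos_level_complement_def)
    then have "\<not> emeasure R (f -` {f x} \<inter> space R) > 0"
      using x by (auto simp: pos_level_complement_def)
    then show "x \<in> ?W'"
      using xR em[of "f x"] by (simp add: spR zero_less_iff_neq_zero)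
  next
    fix x assume x: "x \<in> ?W'"
    then have "emeasure R (f -` {f x} \<inter> space R) = 0"
      using em[of "f x"] by simp
    then show "x \<in> ?W"
      using x by (auto simp: pos_level_complement_def spR)
  qed
  have fin: "finite_measure (distr N borel f)"
    using N f by (rule finite_measure.finite_measure_distr)
  define L where "L = {a. measure (distr N borel f) {a} \<noteq> 0}"
  have L: "countable L"
    unfolding L_def by (rule finite_measure.countable_support[OF fin])
  have "a \<in> L \<longleftrightarrow> emeasure N (f -` {a} \<inter> space N) \<noteq> 0" for a
    using f finite_measure.emeasure_eq_measure[OF N] by (simp add: L_def measure_distr)
  then have "?W' = f -` (B - L) \<inter> space N"
    by auto
  moreover have "B - L \<in> sets borel"
    using B L by (intro sets.Diff) (auto intro: sets.countable)
  ultimately show W: "?W \<in> sets N"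
    using measurable_sets[OF f] unfolding eq by simp
  have sub: "?W \<subseteq> f -` B \<inter> space N"
    unfolding eq by auto
  have WR: "?W \<in> sets R"
    unfolding R_def using W sub \<Omega> by (subst sets_restrict_space_iff) (auto simp: R_def)
  show "space (restrict_space R ?W) = ?W"
    using sub by (auto simp: space_restrict_space spR)
  show "A \<in> null_sets (restrict_space R ?W) \<longleftrightarrow> A \<subseteq> ?W \<and> A \<in> null_sets N"
    unfolding null_sets_restrict_space[OF WR]
    unfolding R_def null_sets_restrict_space[OF \<Omega>] using sub by (auto simp: R_def)
qed

section \<open>From a polar factorisation to countable level sets of the gradient\<close>

theorem theorem2:
  fixes M :: "'a measure" and u :: "'a \<Rightarrow> 'b::euclidean_space"
    and Y :: "'b set" and v :: "'b \<Rightarrow> 'b" and B :: "'b set"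
  assumes "Y \<in> sets lebesgue" and "0 < emeasure lebesgue Y" and "emeasure lebesgue Y < \<infinity>"
    and "measure_interval M"
    and "emeasure M (space M) = emeasure lebesgue Y"
    and "integrable M u"
    and "monotone_rearrangement M u Y v"
    and "B \<in> sets borel"
    and "\<not> on_pos_level_complement almost_injective
            (restrict_space (restrict_space lebesgue Y) (v -` B \<inter> Y)) v"
    and "on_pos_level_complement almost_countable_to_one
            (restrict_space M (u -` B \<inter> space M)) u"
  shows "\<not> has_polar_factorisation M u Y v"
proof
  assume "has_polar_factorisation M u Y v"
  then obtain s where s: "measure_preserving_to M Y s" and us: "AE x in M. u x = v (s x)"
    unfolding has_polar_factorisation_def by blast
  define N where "N = lebesgue_on Y"
  have spN: "space N = Y"
    by (simp add: N_def space_restrict_space)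
  have re: "is_rearrangement M u N v"
    using assms(7) by (simp add: monotone_rearrangement_def N_def)
  then have fin: "finite_measure M" "finite_measure N"
    and u: "u \<in> borel_measurable M" and v: "v \<in> borel_measurable N"
    and eq: "\<And>A. A \<in> sets borel \<Longrightarrow> emeasure M (u -` A \<inter> space M) = emeasure N (v -` A \<inter> space N)"
    by (auto simp: is_rearrangement_def)
  obtain \<psi> where \<psi>: "proper_lsc_convex \<psi>"
    and grad: "AE y in lebesgue. y \<in> Y \<longrightarrow> is_gradient_at \<psi> (v y) y"
    using assms(7) unfolding monotone_rearrangement_def by blast

  define W where "W = pos_level_complement (restrict_space N (v -` B \<inter> space N)) v"
  note W = pos_level_complement_restrict[OF fin(2) v assms(8), folded W_def]
  define X where "X = pos_level_complement (restrict_space M (u -` B \<inter> space M)) u"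
  note X = pos_level_complement_restrict[OF fin(1) u assms(8), folded X_def]
  obtain U' where U': "U' \<subseteq> X" "X - U' \<in> null_sets M" "\<And>a. countable (u -` {a} \<inter> U')"
    using assms(10) X(4)
    unfolding on_pos_level_complement_def almost_countable_to_one_def X_def[symmetric] X(3) by blast
  obtain Z where Z: "Z \<in> null_sets M" "{x\<in>space M. u x \<noteq> v (s x)} \<subseteq> Z"
    using us unfolding eventually_ae_filter by blast
  obtain N0 where N0: "N0 \<in> null_sets lebesgue" "{y. \<not> (y \<in> Y \<longrightarrow> is_gradient_at \<psi> (v y) y)} \<subseteq> N0"
    using grad unfolding eventually_ae_filter by auto

  have WY: "W \<subseteq> Y"
    unfolding W(1) spN by auto
  have "W \<in> sets lebesgue"
    using W(2) WY assms(1) by (auto simp: N_def sets_restrict_space_iff)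
  \<comment> \<open>On \<open>W0\<close> the map \<open>v\<close> is the gradient at every point,
    not merely almost everywhere.\<close>
  define W0 where "W0 = W - N0"
  have "\<exists>U\<subseteq>W0. W0 - U \<in> null_sets lebesgue \<and> inj_on v U"
  proof (rule gradient_almost_injective[OF \<psi>])
    show "W0 \<in> sets lebesgue"
      using \<open>W \<in> sets lebesgue\<close> N0(1) by (auto simp: W0_def)
    show "v \<in> borel_measurable (lebesgue_on W0)"
      using v unfolding N_def by (rule measurable_restrict_mono) (use WY in \<open>auto simp: W0_def\<close>)
    show "is_gradient_at \<psi> (v y) y" if "y \<in> W0" for y
      using that N0(2) WY by (auto simp: W0_def)
    fix C assume C: "compact C" "C \<subseteq> W0" "emeasure lebesgue C \<noteq> 0"
    have CY: "C \<subseteq> Y" and CW: "C \<subseteq> W"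
      using C(2) WY by (auto simp: W0_def)
    \<comment> \<open>Only null sets are removed: the points where \<open>u\<close> and
      \<open>v \<circ> s\<close> may differ, and the part of \<open>X\<close> outside
      \<open>U'\<close>. Membership in \<open>X\<close> itself is recovered below from the value of
      \<open>u\<close>.\<close>
    define P where "P = s -` C \<inter> space M - (Z \<union> (X - U'))"
    have sC: "s -` C \<inter> space M \<in> sets M" "emeasure M (s -` C \<inter> space M) = emeasure lebesgue C"
      using s C(1) CY by (auto simp: measure_preserving_to_def compact_imp_closed)
    have null: "Z \<union> (X - U') \<in> null_sets M"
      using Z(1) U'(2) by (rule null_sets.Un)
    have P: "P \<in> sets M" "emeasure M P \<noteq> 0" "s ` P \<subseteq> C"
      using sC null C(3) emeasure_Diff_null_set[OF null sC(1)] by (auto simp: P_def)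
    obtain F where F: "compact F" "F \<subseteq> s ` P" "emeasure lebesgue F \<noteq> 0"
      using measure_interval_compact_in_image[OF assms(4) s C(1) CY P(1,3,2)] by blast
    have "countable {y\<in>F. v y = a}" for a
    proof (rule countable_subset)
      \<comment> \<open>A level set of \<open>v\<close> in \<open>F\<close> is covered by the image
        under \<open>s\<close> of a countable part of a level set of \<open>u\<close>.\<close>
      show "{y\<in>F. v y = a} \<subseteq> s ` (u -` {a} \<inter> U')"
      proof
        fix y assume "y \<in> {y\<in>F. v y = a}"
        then obtain x where x: "x \<in> P" "y = s x" "v y = a"
          using F(2) by auto
        have xM: "x \<in> space M" and yW: "y \<in> W" and ux: "u x = a"
          using x Z(2) CW by (auto simp: P_def)
        \<comment> \<open>Since \<open>u\<close> and \<open>v\<close> are rearrangements, the level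
          sets with value \<open>a\<close> have equal measure; that of \<open>v\<close> is null
          because \<open>y\<close> lies in \<open>W\<close>.\<close>
        have "emeasure M (u -` {u x} \<inter> space M) = 0" "u x \<in> B"
          using yW eq[of "{a}"] x(3) unfolding W(1) ux by auto
        then have "x \<in> X"
          unfolding X(1) using xM by simp
        then have "x \<in> u -` {a} \<inter> U'"
          using x(1) ux by (auto simp: P_def)
        then show "y \<in> s ` (u -` {a} \<inter> U')"
          using x(2) by blast
      qed
    qed (use U'(3) in auto)
    then show "\<exists>F\<subseteq>C. compact F \<and> emeasure lebesgue F \<noteq> 0 \<and> (\<forall>a. countable {y\<in>F. v y = a})"
      using F P(3) by blast
  qed
  then obtain U where U: "U \<subseteq> W0" "W0 - U \<in> null_sets lebesgue" "inj_on v U"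
    by blast
  \<comment> \<open>The null set \<open>N0\<close> removed above is put back into the exceptional
    set.\<close>
  have "W - U = (W0 - U) \<union> (N0 \<inter> W)"
    using U(1) by (auto simp: W0_def)
  also have "\<dots> \<in> null_sets lebesgue"
    using U(2) N0(1) \<open>W \<in> sets lebesgue\<close> by (intro null_sets.Un null_set_Int2) auto
  finally have "W - U \<in> null_sets N"
    using assms(1) WY by (auto simp: N_def null_sets_restrict_space)
  then have "on_pos_level_complement almost_injective (restrict_space N (v -` B \<inter> space N)) v"
    unfolding on_pos_level_complement_def almost_injective_def W_def[symmetric] W(3)
    using W(4) U(1,3) by (intro exI[of _ U]) (auto simp: W0_def)
  then show False
    using assms(9) by (simp add: spN N_def[symmetric])
qed

end
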